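(* Let $X\in\mathbb R^{n\times p}$ and let $F(\beta,y)=F_0(X\beta,y)$ with $F_0:\mathbb R^n\times\mathbb R^n\to\mathbb R$, where $F(\cdot,y)\in C^2(\mathbb R^p)$ for all $y\in\mathbb R^n$, $F(\beta,\cdot)\in C^2(\mathbb R^n)$ for all $\beta\in\mathbb R^p$, and the Hessian $\nabla^2F_0(\mu,y)$ in the first variable is positive definite for all $(\mu,y)\in\mathbb R^n\times\mathbb R^n$. Consider $$(P(y))\qquad\min_{\beta\in\mathbb R^p}F_0(X\beta,y)+J(\beta).$$ The non-injectivity set $\mathcal G$ (defined in the context) is empty when: (i) $J:\mathbb R^p\to\mathbb R\cup\{+\infty\}$ is proper, lower semicontinuous, convex and polyhedral, and in particular when $J$ is the Lasso penalty $\|\beta\|_1$, the general Lasso penalty $\|D^*\beta\|_1$ (with $D\in\mathbb R^{p\times q}$), or the $\ell^\infty$ penalty $\|\beta\|_\infty$; (ii) $J$ is the general group Lasso penalty $J(\beta)=\|D^*\beta\|_{1,2}=\sum_{b\in\mathcal B}\|D_b^*\beta\|_2$, where $\{D_b\}_{b\in\mathcal B}$ is a (finite) collection of linear operators, and a fortiori when $J$ is the group Lasso penalty $J(\beta)=\sum_{b\in\mathcal B}\|\beta_b\|_2$, where $\mathcal B$ is a partition of $\{1,\dots,p\}$ into blocks and $\beta_b=(\beta_i)_{i\in b}$.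
   Context: Notation. $\nabla F$ and $\nabla^2F$ are derivatives in the first variable; $\mathrm P_E$ is the orthogonal projector on $E$; $\mathrm{Lin}(C)=\mathbb R(C-C)$; $\mathrm{rbd}$, $\mathrm{bd}$ denote relative boundary and boundary. For $\beta$ with $\partial J(\beta)\ne\emptyset$, $S_\beta=\mathrm{Lin}(\partial J(\beta))$ and $T_\beta=S_\beta^\perp$. In case (i), $J$ is partly smooth at $\beta$ relative to the affine manifold $\mathcal M_\beta=\beta+T_\beta$. In case (ii), $J$ is partly smooth at $\beta$ relative to $\mathcal M_\beta=T_\beta=\{h: D_b^*h=0\text{ for all }b\in\mathcal B\text{ with }D_b^*\beta=0\}$. (Partly smooth at $\beta$ relative to $\mathcal M_\beta$ means: $\mathcal M_\beta$ is a $C^2$ manifold and $J$ restricted to it is $C^2$ near $\beta$, the tangent space of $\mathcal M_\beta$ at $\beta$ is $T_\beta$, and $\partial J$ is continuous at $\beta$ relative to $\mathcal M_\beta$.) Since these manifolds are affine, the Riemannian Hessians on $T_\beta$ are $\nabla^2_{\mathcal M}F(\beta,y)=\mathrm P_{T_\beta}\nabla^2F(\beta,y)\mathrm P_{T_\beta}$ and $\nabla^2_{\mathcal M}J(\beta)=\mathrm P_{T_\beta}\nabla^2\tilde J(\beta)\mathrm P_{T_\beta}$, where $\tilde J$ is any smooth ($C^2$) function on $\mathbb R^p$ agreeing with $J$ on $\mathcal M_\beta$ near $\beta$. Condition $(\mathcal C_{\beta,y})$: $\langle(\nabla^2_{\mathcal M}F(\beta,y)+\nabla^2_{\mathcal M}J(\beta))\xi,\xi\rangle>0$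 for all $0\neq\xi\in T_\beta$, with $\mathcal M=\mathcal M_\beta$. With $\mathscr M=\{\mathcal M_\beta\}_{\beta\in\mathbb R^p}$ and $\widetilde{\mathcal M}=\{\beta'\in\mathbb R^p:\mathcal M_{\beta'}=\mathcal M\}$, the transition space is $\mathcal H=\bigcup_{\mathcal M\in\mathscr M}\mathrm{bd}(\Pi(\mathcal A_{\mathcal M}))$, where $\Pi(y,\beta)=y$ and $\mathcal A_{\mathcal M}=\{(y,\beta)\in\mathbb R^n\times\widetilde{\mathcal M}:-\nabla F(\beta,y)\in\mathrm{rbd}\,\partial J(\beta)\}$. Non-injectivity set: $\mathcal G=\{y\notin\mathcal H:(\mathcal C_{\hat\beta(y),y})$ does not hold for any minimizer $\hat\beta(y)$ of $(P(y))\}$.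
   Formalization: G is taken over those y for which (P(y)) has a minimizer; for polyhedral J, the general Lasso and the general group Lasso it is also assumed that Ker X contains no nonzero direction along which J is constant (else false, e.g. X=0, J=0). *)

theory Defs
  imports "HOL-Analysis.Analysis"
begin

subsection \<open>Second-order calculus\<close>

definition grad :: "(real^'m \<Rightarrow> real) \<Rightarrow> real^'m \<Rightarrow> real^'m" where
  "grad f x = (THE g. GDERIV f x :> g)"

definition hess :: "(real^'m \<Rightarrow> real) \<Rightarrow> real^'m \<Rightarrow> real^'m^'m" where
  "hess f x = jacobian (grad f) (at x)"

text \<open>\<^const>\<open>grad\<close> and \<^const>\<open>hess\<close> are only meaningful
  for functions that are differentiable, respectively twice differentiable, at the point.\<close>

definition twice_differentiable :: "(real^'m \<Rightarrow> real) \<Rightarrow> bool" where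
  "twice_differentiable f \<longleftrightarrow>
     (\<forall>x. f differentiable (at x)) \<and> (\<forall>x. grad f differentiable (at x))"

definition C2 :: "(real^'m \<Rightarrow> real) \<Rightarrow> bool" where
  "C2 f \<longleftrightarrow> twice_differentiable f \<and> continuous_on UNIV (hess f)"

text \<open>Hessians are symmetric, so symmetry is not part of the definition.\<close>

definition positive_definite :: "real^'m^'m \<Rightarrow> bool" where
  "positive_definite A \<longleftrightarrow> (\<forall>v. v \<noteq> 0 \<longrightarrow> (A *v v) \<bullet> v > 0)"


subsection \<open>Extended-real-valued convex functions\<close>

definition epi :: "('a \<Rightarrow> ereal) \<Rightarrow> ('a \<times> real) set" where
  "epi J = {(x, r). J x \<le> ereal r}"

definition proper_fun :: "('a \<Rightarrow> ereal) \<Rightarrow> bool" where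
  "proper_fun J \<longleftrightarrow> (\<forall>x. J x \<noteq> -\<infinity>) \<and> (\<exists>x. J x \<noteq> \<infinity>)"

definition lsc_fun :: "('a::topological_space \<Rightarrow> ereal) \<Rightarrow> bool" where
  "lsc_fun J \<longleftrightarrow> (\<forall>x. J x \<le> Liminf (at x) J)"

definition convex_fun :: "('a::real_vector \<Rightarrow> ereal) \<Rightarrow> bool" where
  "convex_fun J \<longleftrightarrow> convex (epi J)"

definition polyhedral_fun :: "('a::euclidean_space \<Rightarrow> ereal) \<Rightarrow> bool" where
  "polyhedral_fun J \<longleftrightarrow> polyhedron (epi J)"

text \<open>For a proper \<open>J\<close> this is empty outside the effective domain of \<open>J\<close>.\<close>

definition subdiff :: "('a::real_inner \<Rightarrow> ereal) \<Rightarrow> 'a \<Rightarrow> 'a set" where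
  "subdiff J \<beta> = {u. \<forall>z. J \<beta> + ereal (u \<bullet> (z - \<beta>)) \<le> J z}"

text \<open>The constancy space of \<open>J\<close>: the directions along which \<open>J\<close> is constant
  on every line. A nonzero such direction in the kernel of \<open>X\<close> lies in every model space
  \<open>T\<^sub>\<beta>\<close> and annihilates the quadratic form of the injectivity condition defined below, which
  then fails at every \<open>\<beta>\<close> (take \<open>X = 0\<close> and \<open>J = 0\<close>).\<close>

definition constancy_space :: "('a::real_vector \<Rightarrow> ereal) \<Rightarrow> 'a set" where
  "constancy_space J = {h. \<forall>\<beta> t. J (\<beta> + t *\<^sub>R h) = J \<beta>}"


subsection \<open>Model spaces and model manifolds\<close>

definition Lin :: "'a::real_vector set \<Rightarrow> 'a set" where
  "Lin C = {t *\<^sub>R (u - v) | t u v. u \<in> C \<and> v \<in> C}"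

definition model_space :: "('a::real_inner \<Rightarrow> ereal) \<Rightarrow> 'a \<Rightarrow> 'a set" where
  "model_space J \<beta> = orthogonal_comp (Lin (subdiff J \<beta>))"

text \<open>The two choices of the manifold \<open>\<M>\<^sub>\<beta>\<close>: the affine space \<open>\<beta> + T\<^sub>\<beta>\<close> for polyhedral
  penalties, and the linear space \<open>T\<^sub>\<beta>\<close> itself for group penalties. The definitions below
  take the map \<open>\<beta> \<mapsto> \<M>\<^sub>\<beta>\<close> as the parameter \<open>Mf\<close>.\<close>

definition affine_manifold :: "('a::real_inner \<Rightarrow> ereal) \<Rightarrow> 'a \<Rightarrow> 'a set" where
  "affine_manifold J \<beta> = (\<lambda>h. \<beta> + h) ` model_space J \<beta>"

definition linear_manifold :: "('a::real_inner \<Rightarrow> ereal) \<Rightarrow> 'a \<Rightarrow> 'a set" where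
  "linear_manifold J \<beta> = model_space J \<beta>"


subsection \<open>Riemannian Hessians and the injectivity condition\<close>

text \<open>On a subspace, \<^const>\<open>closest_point\<close> is the orthogonal projector.\<close>

definition riemannian_hess :: "(real^'p) set \<Rightarrow> (real^'p \<Rightarrow> real) \<Rightarrow> real^'p \<Rightarrow> real^'p \<Rightarrow> real^'p" where
  "riemannian_hess T f \<beta> \<xi> = closest_point T (hess f \<beta> *v closest_point T \<xi>)"

definition smooth_representative ::
    "(real^'p \<Rightarrow> ereal) \<Rightarrow> (real^'p) set \<Rightarrow> real^'p \<Rightarrow> (real^'p \<Rightarrow> real) \<Rightarrow> bool" where
  "smooth_representative J M \<beta> Jt \<longleftrightarrow>
     C2 Jt \<and> (\<forall>\<^sub>F x in nhds \<beta>. x \<in> M \<longrightarrow> J x = ereal (Jt x))"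

text \<open>The Hessian of \<open>J\<close> along \<open>\<M>\<^sub>\<beta>\<close> is computed from any smooth representative of \<open>J\<close>, and
  does not depend on it. The condition asks that there be one, and that the form be positive
  for all of them, so it makes no choice and cannot hold for want of a representative.\<close>

definition injectivity_condition ::
    "(real^'p \<Rightarrow> 'y \<Rightarrow> real) \<Rightarrow> (real^'p \<Rightarrow> ereal) \<Rightarrow> (real^'p \<Rightarrow> (real^'p) set) \<Rightarrow> real^'p \<Rightarrow> 'y \<Rightarrow> bool"
  where
  "injectivity_condition F J Mf \<beta> y \<longleftrightarrow>
     (\<exists>Jt. smooth_representative J (Mf \<beta>) \<beta> Jt) \<and>
     (\<forall>Jt. smooth_representative J (Mf \<beta>) \<beta> Jt \<longrightarrow>
        (\<forall>\<xi>\<in>model_space J \<beta>. \<xi> \<noteq> 0 \<longrightarrow>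
           (riemannian_hess (model_space J \<beta>) (\<lambda>b. F b y) \<beta> \<xi>
            + riemannian_hess (model_space J \<beta>) Jt \<beta> \<xi>) \<bullet> \<xi> > 0))"


subsection \<open>Data fidelity, minimizers, transition space and non-injectivity set\<close>

definition fidelity :: "real^'p^'n \<Rightarrow> (real^'n \<Rightarrow> 'y \<Rightarrow> real) \<Rightarrow> real^'p \<Rightarrow> 'y \<Rightarrow> real" where
  "fidelity X F0 \<beta> y = F0 (X *v \<beta>) y"

definition minimizers ::
    "(real^'p \<Rightarrow> 'y \<Rightarrow> real) \<Rightarrow> (real^'p \<Rightarrow> ereal) \<Rightarrow> 'y \<Rightarrow> (real^'p) set" where
  "minimizers F J y = {\<beta>. \<forall>\<beta>'. ereal (F \<beta> y) + J \<beta> \<le> ereal (F \<beta>' y) + J \<beta>'}"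

text \<open>\<open>\<M>\<^sub>\<beta>\<close> is only considered at points \<open>\<beta>\<close> where \<open>J\<close> has a subgradient.\<close>

definition manifold_family ::
    "(real^'p \<Rightarrow> ereal) \<Rightarrow> (real^'p \<Rightarrow> (real^'p) set) \<Rightarrow> (real^'p) set set" where
  "manifold_family J Mf = {Mf \<beta> | \<beta>. subdiff J \<beta> \<noteq> {}}"

definition manifold_stratum ::
    "(real^'p \<Rightarrow> ereal) \<Rightarrow> (real^'p \<Rightarrow> (real^'p) set) \<Rightarrow> (real^'p) set \<Rightarrow> (real^'p) set" where
  "manifold_stratum J Mf M = {\<beta>. subdiff J \<beta> \<noteq> {} \<and> Mf \<beta> = M}"

definition transition_pairs ::
    "(real^'p \<Rightarrow> 'y \<Rightarrow> real) \<Rightarrow> (real^'p \<Rightarrow> ereal) \<Rightarrow> (real^'p \<Rightarrow> (real^'p) set) \<Rightarrow>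
     (real^'p) set \<Rightarrow> ('y \<times> (real^'p)) set" where
  "transition_pairs F J Mf M =
     {(y, \<beta>). \<beta> \<in> manifold_stratum J Mf M \<and>
              - grad (\<lambda>b. F b y) \<beta> \<in> rel_frontier (subdiff J \<beta>)}"

definition transition_space ::
    "(real^'p \<Rightarrow> 'y::topological_space \<Rightarrow> real) \<Rightarrow> (real^'p \<Rightarrow> ereal) \<Rightarrow>
     (real^'p \<Rightarrow> (real^'p) set) \<Rightarrow> 'y set" where
  "transition_space F J Mf =
     (\<Union>M\<in>manifold_family J Mf. frontier (fst ` transition_pairs F J Mf M))"

text \<open>The set concerns those \<open>y\<close> for which the problem has a solution; for a \<open>y\<close> without any
  minimizer the last conjunct would be vacuous.\<close>

definition non_injectivity_set ::
    "(real^'p \<Rightarrow> 'y::topological_space \<Rightarrow> real) \<Rightarrow> (real^'p \<Rightarrow> ereal) \<Rightarrow>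
     (real^'p \<Rightarrow> (real^'p) set) \<Rightarrow> 'y set" where
  "non_injectivity_set F J Mf =
     {y. y \<notin> transition_space F J Mf \<and> minimizers F J y \<noteq> {} \<and>
         (\<forall>\<beta>\<in>minimizers F J y. \<not> injectivity_condition F J Mf \<beta> y)}"


subsection \<open>Penalties\<close>

definition lasso :: "real^'p \<Rightarrow> ereal" where
  "lasso \<beta> = ereal (\<Sum>i\<in>UNIV. \<bar>\<beta> $ i\<bar>)"

definition general_lasso :: "real^'q^'p \<Rightarrow> real^'p \<Rightarrow> ereal" where
  "general_lasso D \<beta> = lasso (transpose D *v \<beta>)"

definition linf_penalty :: "real^'p \<Rightarrow> ereal" where
  "linf_penalty \<beta> = ereal (infnorm \<beta>)"

text \<open>All \<open>D b\<close> share the domain \<open>real^'r\<close>. This is no restriction: operators on spaces of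
  different dimensions are padded by zero columns, which changes none of the norms below.\<close>

definition general_group_lasso :: "'b set \<Rightarrow> ('b \<Rightarrow> real^'r^'p) \<Rightarrow> real^'p \<Rightarrow> ereal" where
  "general_group_lasso B D \<beta> = ereal (\<Sum>b\<in>B. norm (transpose (D b) *v \<beta>))"

definition group_lasso :: "'p set set \<Rightarrow> real^'p \<Rightarrow> ereal" where
  "group_lasso B \<beta> = ereal (\<Sum>b\<in>B. L2_set (\<lambda>i. \<beta> $ i) b)"

end

theory Submission
  imports Defs
begin

text \<open>For every \<open>y\<close> whose problem has a solution there is a minimizer at which the injectivity
condition holds: any extreme point of the solution set will do.

Such a point exists. Positive definiteness of the Hessian makes \<open>F0 (\<cdot>) y\<close> strictly convex, so all
minimizers have the same image under \<open>X\<close> and hence the same penalty \<open>c\<close>; the solution set is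
\<open>{z. X z = X \<beta>, J z \<le> c}\<close>, which is closed and convex. If it contained a line of direction \<open>h\<close>,
then \<open>X h = 0\<close> and \<open>J\<close> would be bounded above along that line; a closed convex function bounded
above along one line is constant along all parallel lines, so \<open>h\<close> would be a nonzero element of
\<open>ker X\<close> and of the constancy space of \<open>J\<close>. A nonempty closed convex set without lines has an
extreme point (lemmas \<open>extreme_minimizer\<close> and \<open>extreme_point_of_line_free\<close>).

At an extreme minimizer \<open>\<beta>\<close> the condition holds. For \<open>\<xi> \<in> T\<^sub>\<beta>\<close> the quadratic form of the
condition is the second derivative at \<open>t = 0\<close> of \<open>F (\<beta> + t \<xi>) y + J (\<beta> + t \<xi>)\<close>. Both summands
contribute a nonnegative number, so if the form vanishes at \<open>\<xi>\<close> then \<open>X \<xi> = 0\<close>, and the second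
derivative of \<open>J\<close> along \<open>\<xi>\<close> is zero. For the penalties at hand this forces \<open>J\<close> to be affine, not
merely affine to second order, on a short segment around \<open>\<beta>\<close> in the direction \<open>\<xi>\<close>. As \<open>F\<close> is
constant there, minimality makes \<open>J\<close> constant on the segment, and \<open>\<beta>\<close> is the midpoint of two other
minimizers unless \<open>\<xi> = 0\<close> (lemma \<open>injectivity_condition_at_extreme_minimizer\<close>).

What remains is specific to the penalty. A polyhedral \<open>J\<close> is affine on \<open>\<beta> + T\<^sub>\<beta>\<close> near \<open>\<beta>\<close>, because
\<open>T\<^sub>\<beta>\<close> is orthogonal to all differences of subgradients and every halfspace of a representation of the epigraph
whose boundary passes through \<open>(\<beta>, J \<beta>)\<close> gives a subgradient or a direction in which subgradients can be moved
(lemma \<open>polyhedral_affine_on_model_space\<close>). For the group penalty, if \<open>v \<noteq> 0\<close> then \<open>t \<mapsto> norm (v + t w)\<close> has second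
derivative zero at \<open>t = 0\<close> exactly when \<open>w\<close> is a multiple of \<open>v\<close> (equality in Cauchy-Schwarz), and
then it is affine near \<open>0\<close> (lemma \<open>group_lasso_along_line\<close>). The \<open>C\<^sup>2\<close> function that represents the
group penalty on \<open>T\<^sub>\<beta>\<close> is built from a \<open>C\<^sup>2\<close> extension of the square root from \<open>[a, \<infinity>)\<close>, \<open>a > 0\<close>, to
the whole real line
(lemma \<open>group_smooth_representative\<close>).\<close>

section \<open>Second derivatives along lines\<close>

lemma GDERIV_imp_grad:
  fixes f :: "real^'m \<Rightarrow> real"
  assumes "GDERIV f x :> g"
  shows "grad f x = g"
  unfolding grad_def
proof (rule the_equality[where P = "\<lambda>g. GDERIV f x :> g", OF assms])
  fix g' assume "GDERIV f x :> g'"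
  then have "(\<lambda>h. h \<bullet> g') = (\<lambda>h. h \<bullet> g)"
    using assms unfolding gderiv_def by (rule has_derivative_unique)
  then show "g' = g"
    by (metis vector_eq_ldot)
qed

lemma GDERIV_grad:
  fixes f :: "real^'m \<Rightarrow> real"
  assumes "f differentiable (at x)"
  shows "GDERIV f x :> grad f x"
proof -
  obtain f' where f': "(f has_derivative f') (at x)"
    using assms by (auto simp: differentiable_def)
  have "f' = (\<lambda>h. h \<bullet> adjoint f' 1)"
    using adjoint_works[OF has_derivative_linear[OF f'], of _ 1] by (simp add: fun_eq_iff)
  then have "GDERIV f x :> adjoint f' 1"
    using f' by (simp add: gderiv_def)
  then show ?thesis
    by (simp add: GDERIV_imp_grad)
qed

lemma has_derivative_grad:
  assumes "twice_differentiable f"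
  shows "(grad f has_derivative (\<lambda>h. hess f x *v h)) (at x)"
  using assms unfolding twice_differentiable_def hess_def jacobian_works by blast

text \<open>Criterion by which concrete functions are recognised as \<open>C\<^sup>2\<close>: it replaces the choice operators
  inside \<^const>\<open>grad\<close> and \<^const>\<open>hess\<close> by an explicit gradient \<open>g\<close> and Hessian \<open>H\<close>.\<close>

lemma C2I:
  fixes f :: "real^'m \<Rightarrow> real"
  assumes g: "\<And>x. GDERIV f x :> g x"
    and H: "\<And>x. (g has_derivative (\<lambda>h. H x *v h)) (at x)"
    and cont: "continuous_on UNIV H"
  shows "C2 f"
proof -
  have grad: "grad f = g"
    using GDERIV_imp_grad[OF g] by blast
  have "hess f x = H x" for x
    using frechet_derivative_at[OF H[of x]]
    by (simp add: hess_def grad jacobian_def flip: \<open>_ = frechet_derivative g (at x)\<close>)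
  then have "hess f = H"
    by blast
  then show ?thesis
    using g H cont unfolding C2_def twice_differentiable_def grad gderiv_def
    by (auto simp: differentiable_def)
qed

lemma C2_sum:
  fixes f :: "'b \<Rightarrow> real^'m \<Rightarrow> real"
  assumes "\<And>b. b \<in> B \<Longrightarrow> C2 (f b)"
  shows "C2 (\<lambda>x. \<Sum>b\<in>B. f b x)"
proof (rule C2I)
  fix x
  have td: "twice_differentiable (f b)" if "b \<in> B" for b
    using assms[OF that] by (simp add: C2_def)
  show "GDERIV (\<lambda>x. \<Sum>b\<in>B. f b x) x :> (\<Sum>b\<in>B. grad (f b) x)"
    unfolding gderiv_def inner_sum_right
    using GDERIV_grad td by (intro has_derivative_sum) (auto simp: twice_differentiable_def gderiv_def)
  have "(\<Sum>b\<in>B. hess (f b) x) *v h = (\<Sum>b\<in>B. hess (f b) x *v h)" for h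
    by (induction B rule: infinite_finite_induct) (auto simp: matrix_vector_mult_add_rdistrib)
  then show "((\<lambda>x. \<Sum>b\<in>B. grad (f b) x) has_derivative (\<lambda>h. (\<Sum>b\<in>B. hess (f b) x) *v h)) (at x)"
    using has_derivative_sum[of B "\<lambda>b. grad (f b)" "\<lambda>b h. hess (f b) x *v h" "at x"]
      has_derivative_grad[OF td] by simp
  show "continuous_on UNIV (\<lambda>x. \<Sum>b\<in>B. hess (f b) x)"
    using assms by (intro continuous_on_sum) (simp add: C2_def)
qed

lemma C2_affine: "C2 (\<lambda>x::real^'m. c + u \<bullet> x)"
proof (rule C2I)
  show "GDERIV (\<lambda>x::real^'m. c + u \<bullet> x) x :> u" for x
    unfolding gderiv_def by (auto intro!: derivative_eq_intros simp: inner_commute)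
  show "((\<lambda>x. u) has_derivative (\<lambda>h. 0 *v h)) (at x)" for x :: "real^'m"
    by simp
qed auto

lemma GDERIV_along_line:
  fixes f :: "real^'m \<Rightarrow> real"
  assumes "f differentiable (at (x + t *\<^sub>R \<xi>))"
  shows "((\<lambda>t. f (x + t *\<^sub>R \<xi>)) has_real_derivative grad f (x + t *\<^sub>R \<xi>) \<bullet> \<xi>) (at t)"
proof -
  have "((\<lambda>t. x + t *\<^sub>R \<xi>) has_derivative (\<lambda>s. s *\<^sub>R \<xi>)) (at t)"
    by (auto intro!: derivative_eq_intros)
  from has_derivative_compose[OF this GDERIV_grad[OF assms, unfolded gderiv_def]]
  have "((\<lambda>t. f (x + t *\<^sub>R \<xi>)) has_derivative (\<lambda>s. (grad f (x + t *\<^sub>R \<xi>) \<bullet> \<xi>) * s)) (at t)"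
    by (simp add: inner_commute mult.commute)
  then show ?thesis
    by (simp add: has_field_derivative_def)
qed

lemma grad_along_line:
  assumes "twice_differentiable f"
  shows "((\<lambda>t. grad f (x + t *\<^sub>R \<xi>) \<bullet> \<xi>) has_real_derivative
           (hess f (x + t *\<^sub>R \<xi>) *v \<xi>) \<bullet> \<xi>) (at t)"
proof -
  have "((\<lambda>t. x + t *\<^sub>R \<xi>) has_derivative (\<lambda>s. s *\<^sub>R \<xi>)) (at t)"
    by (auto intro!: derivative_eq_intros)
  from has_derivative_compose[OF this has_derivative_grad[OF assms]]
  have "((\<lambda>t. grad f (x + t *\<^sub>R \<xi>) \<bullet> \<xi>) has_derivative
           (\<lambda>s. (hess f (x + t *\<^sub>R \<xi>) *v (s *\<^sub>R \<xi>)) \<bullet> \<xi>)) (at t)"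
    by (rule has_derivative_inner_left)
  moreover have "(\<lambda>s. (hess f (x + t *\<^sub>R \<xi>) *v (s *\<^sub>R \<xi>)) \<bullet> \<xi>)
      = (*) ((hess f (x + t *\<^sub>R \<xi>) *v \<xi>) \<bullet> \<xi>)"
    by (simp add: matrix_vector_mult_scaleR fun_eq_iff)
  ultimately show ?thesis
    by (simp add: has_field_derivative_def)
qed

lemma eventually_along_line:
  fixes \<beta> :: "'a::real_normed_vector"
  assumes "\<forall>\<^sub>F x in nhds \<beta>. P x"
  shows "\<forall>\<^sub>F t in nhds 0. P (\<beta> + t *\<^sub>R \<xi>)"
proof -
  have "((\<lambda>t. \<beta> + t *\<^sub>R \<xi>) \<longlongrightarrow> \<beta> + 0 *\<^sub>R \<xi>) (nhds 0)"
    by (intro tendsto_intros filterlim_ident)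
  then show ?thesis
    using assms by (auto elim: eventually_compose_filterlim)
qed

text \<open>The quadratic form of the Hessian at \<open>\<xi>\<close> is a second derivative in one variable, so it depends only
  on the values of \<open>f\<close> on a short segment. This is how the Hessian of an arbitrary smooth representative
  of \<open>J\<close> is computed from \<open>J\<close> itself.\<close>

lemma hess_quadratic_form_along_line:
  fixes f :: "real^'m \<Rightarrow> real"
  assumes f: "twice_differentiable f"
    and eq: "\<forall>\<^sub>F t in nhds 0. f (x + t *\<^sub>R \<xi>) = \<phi> t"
    and \<phi>': "\<forall>\<^sub>F t in nhds 0. (\<phi> has_real_derivative \<phi>' t) (at t)"
    and \<phi>'': "(\<phi>' has_real_derivative q) (at 0)"
  shows "(hess f x *v \<xi>) \<bullet> \<xi> = q"
proof -
  have ev: "\<forall>\<^sub>F t in nhds 0. grad f (x + t *\<^sub>R \<xi>) \<bullet> \<xi> = \<phi>' t"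
    using eventually_eventually[THEN iffD2, OF eq] \<phi>'
  proof eventually_elim
    case (elim t)
    have "((\<lambda>t. f (x + t *\<^sub>R \<xi>)) has_real_derivative \<phi>' t) (at t)"
      using elim DERIV_cong_ev[OF refl elim(1) refl] by blast
    moreover have "((\<lambda>t. f (x + t *\<^sub>R \<xi>)) has_real_derivative grad f (x + t *\<^sub>R \<xi>) \<bullet> \<xi>) (at t)"
      using f by (intro GDERIV_along_line) (simp add: twice_differentiable_def)
    ultimately show ?case
      using DERIV_unique by blast
  qed
  then have "((\<lambda>t. grad f (x + t *\<^sub>R \<xi>) \<bullet> \<xi>) has_real_derivative q) (at 0)"
    using \<phi>'' by (subst DERIV_cong_ev[OF refl ev refl])
  moreover have "((\<lambda>t. grad f (x + t *\<^sub>R \<xi>) \<bullet> \<xi>) has_real_derivative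
      (hess f x *v \<xi>) \<bullet> \<xi>) (at 0)"
    using grad_along_line[OF f, of x \<xi> 0] by simp
  ultimately show ?thesis
    using DERIV_unique by blast
qed

text \<open>The form is \<open>\<langle>X\<^sup>T (\<nabla>\<^sup>2 F0) X \<xi>, \<xi>\<rangle>\<close>. It is read off from the second derivatives of
  \<open>t \<mapsto> F0 (X \<beta> + t X \<xi>) y\<close>, computed on either side of \<open>X\<close>.\<close>

lemma hess_fidelity_quadratic_form:
  fixes X :: "real^'p^'n"
  assumes "twice_differentiable (\<lambda>\<beta>. fidelity X F0 \<beta> y)" "twice_differentiable (\<lambda>\<mu>. F0 \<mu> y)"
  shows "(hess (\<lambda>\<beta>. fidelity X F0 \<beta> y) \<beta> *v \<xi>) \<bullet> \<xi>
           = (hess (\<lambda>\<mu>. F0 \<mu> y) (X *v \<beta>) *v (X *v \<xi>)) \<bullet> (X *v \<xi>)"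
proof (rule hess_quadratic_form_along_line[OF assms(1)])
  let ?f = "\<lambda>\<mu>. F0 \<mu> y"
  show "\<forall>\<^sub>F t in nhds 0. fidelity X F0 (\<beta> + t *\<^sub>R \<xi>) y = ?f (X *v \<beta> + t *\<^sub>R (X *v \<xi>))"
    by (simp add: fidelity_def matrix_vector_right_distrib matrix_vector_mult_scaleR)
  show "\<forall>\<^sub>F t in nhds 0. ((\<lambda>t. ?f (X *v \<beta> + t *\<^sub>R (X *v \<xi>))) has_real_derivative
          grad ?f (X *v \<beta> + t *\<^sub>R (X *v \<xi>)) \<bullet> (X *v \<xi>)) (at t)"
    using assms(2) by (intro always_eventually allI GDERIV_along_line)
      (simp add: twice_differentiable_def)
  show "((\<lambda>t. grad ?f (X *v \<beta> + t *\<^sub>R (X *v \<xi>)) \<bullet> (X *v \<xi>)) has_real_derivative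
          (hess ?f (X *v \<beta>) *v (X *v \<xi>)) \<bullet> (X *v \<xi>)) (at 0)"
    using grad_along_line[OF assms(2), of "X *v \<beta>" "X *v \<xi>" 0] by simp
qed

definition midpoint_strictly_convex :: "('a::real_vector \<Rightarrow> real) \<Rightarrow> bool" where
  "midpoint_strictly_convex f \<longleftrightarrow>
     (\<forall>\<mu> \<nu>. \<mu> \<noteq> \<nu> \<longrightarrow> f ((1/2) *\<^sub>R \<mu> + (1/2) *\<^sub>R \<nu>) < (f \<mu> + f \<nu>) / 2)"

text \<open>Along the segment from \<open>\<mu>\<close> to \<open>\<nu>\<close> the first derivative is strictly increasing, so by the mean value
  theorem the second half of the segment adds more to \<open>f\<close> than the first half.\<close>

lemma midpoint_strictly_convex_posdef:
  fixes f :: "real^'m \<Rightarrow> real"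
  assumes f: "twice_differentiable f" and pd: "\<And>x. positive_definite (hess f x)"
  shows "midpoint_strictly_convex f"
  unfolding midpoint_strictly_convex_def
proof (intro allI impI)
  fix \<mu> \<nu> :: "real^'m" assume "\<mu> \<noteq> \<nu>"
  define w where "w = \<nu> - \<mu>"
  let ?\<phi> = "\<lambda>t. f (\<mu> + t *\<^sub>R w)" and ?\<phi>' = "\<lambda>t. grad f (\<mu> + t *\<^sub>R w) \<bullet> w"
  have w: "w \<noteq> 0"
    using \<open>\<mu> \<noteq> \<nu>\<close> by (simp add: w_def)
  have d: "(?\<phi> has_real_derivative ?\<phi>' t) (at t)" for t
    using f by (intro GDERIV_along_line) (simp add: twice_differentiable_def)
  have mono: "?\<phi>' s < ?\<phi>' t" if "s < t" for s t
    using that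
  proof (rule DERIV_pos_imp_increasing)
    show "\<exists>z. (?\<phi>' has_real_derivative z) (at r) \<and> 0 < z" for r
      using grad_along_line[OF f, of \<mu> w r] pd w unfolding positive_definite_def by blast
  qed
  obtain a where a: "a < 1/2" "?\<phi> (1/2) - ?\<phi> 0 = (1/2 - 0) * ?\<phi>' a"
    using MVT2[of 0 "1/2" ?\<phi> ?\<phi>'] d by auto
  obtain b where b: "1/2 < b" "?\<phi> 1 - ?\<phi> (1/2) = (1 - 1/2) * ?\<phi>' b"
    using MVT2[of "1/2" 1 ?\<phi> ?\<phi>'] d by auto
  have "?\<phi> (1/2) < (?\<phi> 0 + ?\<phi> 1) / 2"
    using mono[of a b] a b by simp
  moreover have "\<mu> + (1/2) *\<^sub>R w = (1/2) *\<^sub>R \<mu> + (1/2) *\<^sub>R \<nu>"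
    by (simp add: w_def vec_eq_iff field_simps)
  ultimately show "f ((1/2) *\<^sub>R \<mu> + (1/2) *\<^sub>R \<nu>) < (f \<mu> + f \<nu>) / 2"
    by (simp add: w_def)
qed

text \<open>The variational inequality of the projection, tested with \<open>p + \<xi>\<close> and \<open>p - \<xi>\<close>, gives orthogonality
  of the residual to \<open>T\<close>.\<close>

lemma closest_point_inner_subspace:
  fixes T :: "'a::euclidean_space set"
  assumes T: "subspace T" and \<xi>: "\<xi> \<in> T"
  shows "closest_point T v \<bullet> \<xi> = v \<bullet> \<xi>"
proof -
  let ?p = "closest_point T v"
  have cv: "convex T" and cl: "closed T"
    using T by (auto simp: subspace_imp_convex closed_subspace)
  have p: "?p \<in> T"
    using closest_point_in_set[OF cl] \<xi> by blast
  have "(v - ?p) \<bullet> ((?p + \<xi>) - ?p) \<le> 0" "(v - ?p) \<bullet> ((?p - \<xi>) - ?p) \<le> 0"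
    using T p \<xi> by (intro closest_point_dot[OF cv cl]; simp add: subspace_add subspace_diff)+
  then show ?thesis
    by (simp add: inner_diff_left)
qed

text \<open>On tangent vectors both projections disappear from the quadratic form.\<close>

lemma riemannian_hess_inner:
  assumes "subspace T" "\<xi> \<in> T"
  shows "riemannian_hess T f \<beta> \<xi> \<bullet> \<xi> = (hess f \<beta> *v \<xi>) \<bullet> \<xi>"
  using closest_point_inner_subspace[OF assms] assms(2)
  by (simp add: riemannian_hess_def closest_point_self)

section \<open>Extreme points of the solution set\<close>

text \<open>Induction on dimension. A convex set that is not affine has a relative boundary point, and the
  supporting hyperplane there cuts out a face of smaller dimension whose extreme points are extreme
  points of the whole set; an affine set without lines is a single point.\<close>

lemma extreme_point_of_line_free:
  fixes S :: "'a::euclidean_space set"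
  assumes "closed S" "convex S" "S \<noteq> {}"
    and no_line: "\<And>x d. d \<noteq> 0 \<Longrightarrow> \<exists>t. x + t *\<^sub>R d \<notin> S"
  obtains x where "x extreme_point_of S"
proof -
  have "\<exists>x. x extreme_point_of S"
    using assms
  proof (induction "nat (aff_dim S + 1)" arbitrary: S rule: less_induct)
    case less
    obtain x where x: "x \<in> S"
      using less.prems by blast
    show ?case
    proof (cases "affine S")
      case True
      have "y = x" if y: "y \<in> S" for y
      proof (rule ccontr)
        assume "y \<noteq> x"
        then obtain t where "x + t *\<^sub>R (y - x) \<notin> S"
          using less.prems(4)[of "y - x" x] by auto
        moreover have "(1 - t) *\<^sub>R x + t *\<^sub>R y \<in> S"
          using True x y by (simp add: affine_alt)
        ultimately show False
          by (simp add: algebra_simps)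
      qed
      then have "S = {x}"
        using x by blast
      then show ?thesis
        by (auto simp: extreme_point_of_def)
    next
      case False
      then obtain z where z: "z \<in> rel_frontier S"
        using rel_frontier_eq_empty by blast
      then have zS: "z \<in> S" "z \<notin> rel_interior S"
        using less.prems(1) by (auto simp: rel_frontier_def)
      obtain a where a: "a \<noteq> 0" "\<And>y. y \<in> S \<Longrightarrow> a \<bullet> z \<le> a \<bullet> y"
        "\<And>y. y \<in> rel_interior S \<Longrightarrow> a \<bullet> z < a \<bullet> y"
        using supporting_hyperplane_rel_boundary[OF less.prems(2) zS] by metis
      define E where "E = S \<inter> {y. a \<bullet> y = a \<bullet> z}"
      have face: "E face_of S"
        unfolding E_def using face_of_Int_supporting_hyperplane_ge[OF less.prems(2)] a(2) by blast
      obtain w where w: "w \<in> rel_interior S"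
        using less.prems rel_interior_eq_empty by blast
      then have "w \<in> S" "w \<notin> E"
        using a(3)[OF w] rel_interior_subset by (auto simp: E_def)
      then have "E \<noteq> S"
        by blast
      then have "aff_dim E < aff_dim S"
        using face_of_aff_dim_lt[OF less.prems(2) face] by blast
      moreover have "aff_dim E \<ge> -1"
        by (rule aff_dim_geq)
      ultimately have "nat (aff_dim E + 1) < nat (aff_dim S + 1)"
        by linarith
      moreover have "closed E" "convex E" "E \<noteq> {}"
        using less.prems(1) face_of_imp_convex[OF face] zS(1)
        by (auto simp: E_def closed_Int closed_hyperplane)
      moreover have "\<exists>t. x + t *\<^sub>R d \<notin> E" if "d \<noteq> 0" for x d
        using less.prems(4)[OF that, of x] by (auto simp: E_def)
      ultimately obtain x where "x extreme_point_of E"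
        using less.hyps by blast
      then show ?thesis
        using extreme_point_of_face[OF face] by blast
    qed
  qed
  then show thesis
    using that by blast
qed

lemma convex_fun_le:
  assumes "convex_fun J" "J x \<le> ereal a" "J z \<le> ereal b" "0 \<le> t" "t \<le> 1"
  shows "J ((1 - t) *\<^sub>R x + t *\<^sub>R z) \<le> ereal ((1 - t) * a + t * b)"
proof -
  have "(1 - t) *\<^sub>R (x, a) + t *\<^sub>R (z, b) \<in> epi J"
    using assms by (intro convexD_alt) (auto simp: convex_fun_def epi_def)
  then show ?thesis
    by (simp add: epi_def)
qed

lemma closed_sublevel:
  fixes J :: "'a::euclidean_space \<Rightarrow> ereal"
  assumes "closed (epi J)"
  shows "closed {x. J x \<le> ereal c}"
proof -
  have "closed ((\<lambda>x. (x, c)) -` epi J)"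
    by (intro closed_vimage assms continuous_intros)
  then show ?thesis
    by (simp add: epi_def vimage_def)
qed

text \<open>A point \<open>(x, r)\<close> of the epigraph is joined to points \<open>(\<beta> + (t / s) h, c)\<close> far out on the line. As
  \<open>s\<close> tends to 0, the points at parameter \<open>s\<close> of these segments tend to \<open>(x + t h, r)\<close>, which
  therefore lies in the closed epigraph. So \<open>J\<close> does not increase from \<open>x\<close> to \<open>x + t h\<close>, for any
  \<open>x\<close> and \<open>t\<close>, and exchanging the two points gives equality.\<close>

lemma bounded_line_in_constancy_space:
  fixes J :: "'a::euclidean_space \<Rightarrow> ereal"
  assumes cl: "closed (epi J)" and cv: "convex_fun J"
    and bd: "\<And>t. J (\<beta> + t *\<^sub>R h) \<le> ereal c"
  shows "h \<in> constancy_space J"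
proof -
  have le: "J (x + t *\<^sub>R h) \<le> J x" for x t
  proof (rule ereal_le_real)
    fix r assume r: "J x \<le> ereal r"
    define s where "s n = inverse (real (Suc n))" for n
    let ?p = "\<lambda>n. ((1 - s n) *\<^sub>R x + (s n *\<^sub>R \<beta> + t *\<^sub>R h), (1 - s n) * r + s n * c)"
    have s: "0 \<le> s n" "s n \<le> 1" "s n \<noteq> 0" for n
      by (auto simp: s_def field_simps)
    have "?p n \<in> epi J" for n
      using convex_fun_le[OF cv r bd[of "t / s n"] s(1)[of n] s(2)[of n]] s(3)[of n]
      by (simp add: epi_def algebra_simps)
    moreover have s0: "s \<longlonglongrightarrow> 0"
      unfolding s_def by (rule LIMSEQ_inverse_real_of_nat)
    have "?p \<longlonglongrightarrow> ((1 - 0) *\<^sub>R x + (0 *\<^sub>R \<beta> + t *\<^sub>R h), (1 - 0) * r + 0 * c)"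
      by (intro tendsto_intros s0)
    ultimately have "(x + t *\<^sub>R h, r) \<in> epi J"
      using closed_sequentially[OF cl, of ?p] by simp
    then show "J (x + t *\<^sub>R h) \<le> ereal r"
      by (simp add: epi_def)
  qed
  have "J (x + t *\<^sub>R h) = J x" for x t
    using le[of x t] le[of "x + t *\<^sub>R h" "- t"] by (simp add: order_antisym)
  then show ?thesis
    by (simp add: constancy_space_def)
qed

text \<open>If two minimizers had different images under \<open>X\<close>, strict convexity of the fidelity would make
  their midpoint strictly better. Hence they share the fidelity, and so the penalty.\<close>

lemma minimizers_eq_sublevel:
  assumes pr: "proper_fun J" and cv: "convex_fun J"
    and strict: "midpoint_strictly_convex (\<lambda>\<mu>. F0 \<mu> y)"
    and \<beta>: "\<beta> \<in> minimizers (fidelity X F0) J y"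
  obtains c where "J \<beta> = ereal c"
    "minimizers (fidelity X F0) J y = {z. X *v z = X *v \<beta> \<and> J z \<le> ereal c}"
proof -
  let ?m = "\<lambda>z. ereal (F0 (X *v z) y) + J z"
  have min: "?m \<beta> \<le> ?m z" for z
    using \<beta> by (simp add: minimizers_def fidelity_def)
  obtain z0 where "J z0 \<noteq> \<infinity>" and nm: "\<And>z. J z \<noteq> -\<infinity>"
    using pr by (auto simp: proper_fun_def)
  then have "J \<beta> \<noteq> \<infinity>"
    using min[of z0] by (cases "J z0") auto
  then obtain c where c: "J \<beta> = ereal c"
    using nm[of \<beta>] by (cases "J \<beta>") auto
  have "X *v z = X *v \<beta> \<and> J z \<le> ereal c" if z: "z \<in> minimizers (fidelity X F0) J y" for z
  proof -
    have "?m z \<le> ?m \<beta>"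
      using z by (simp add: minimizers_def fidelity_def)
    then obtain d where d: "J z = ereal d" and eq: "F0 (X *v z) y + d = F0 (X *v \<beta>) y + c"
      using min[of z] nm[of z] c by (cases "J z") auto
    have "X *v z = X *v \<beta>"
    proof (rule ccontr)
      assume "X *v z \<noteq> X *v \<beta>"
      then have lt: "F0 ((1/2) *\<^sub>R (X *v \<beta>) + (1/2) *\<^sub>R (X *v z)) y < (F0 (X *v \<beta>) y + F0 (X *v z) y) / 2"
        using strict by (simp add: midpoint_strictly_convex_def)
      have "J ((1/2) *\<^sub>R \<beta> + (1/2) *\<^sub>R z) \<le> ereal ((c + d) / 2)"
        using convex_fun_le[OF cv, of \<beta> c z d "1/2"] c d by (simp add: field_simps)
      moreover have "X *v ((1/2) *\<^sub>R \<beta> + (1/2) *\<^sub>R z) = (1/2) *\<^sub>R (X *v \<beta>) + (1/2) *\<^sub>R (X *v z)"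
        by (simp add: matrix_vector_right_distrib matrix_vector_mult_scaleR)
      ultimately show False
        using lt eq c nm[of "(1/2) *\<^sub>R \<beta> + (1/2) *\<^sub>R z"] min[of "(1/2) *\<^sub>R \<beta> + (1/2) *\<^sub>R z"]
        by (cases "J ((1/2) *\<^sub>R \<beta> + (1/2) *\<^sub>R z)") (auto simp: field_simps)
    qed
    then show ?thesis
      using eq d by simp
  qed
  moreover have "z \<in> minimizers (fidelity X F0) J y" if "X *v z = X *v \<beta>" "J z \<le> ereal c" for z
  proof -
    have "?m z \<le> ?m \<beta>"
      using that c add_left_mono[of "J z" "J \<beta>" "ereal (F0 (X *v \<beta>) y)"] by simp
    then have "?m z \<le> ?m w" for w
      using min[of w] by (rule order_trans)
    then show ?thesis
      by (simp add: minimizers_def fidelity_def)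
  qed
  ultimately show thesis
    using that c by blast
qed

lemma extreme_minimizer:
  assumes pr: "proper_fun J" and cv: "convex_fun J" and cl: "closed (epi J)"
    and strict: "midpoint_strictly_convex (\<lambda>\<mu>. F0 \<mu> y)"
    and ker: "{h. X *v h = 0} \<inter> constancy_space J = {0}"
    and ne: "minimizers (fidelity X F0) J y \<noteq> {}"
  obtains \<beta> where "\<beta> extreme_point_of minimizers (fidelity X F0) J y"
proof -
  obtain \<beta>0 where "\<beta>0 \<in> minimizers (fidelity X F0) J y"
    using ne by blast
  then obtain c where M: "minimizers (fidelity X F0) J y = {z. X *v z = X *v \<beta>0 \<and> J z \<le> ereal c}"
    by (rule minimizers_eq_sublevel[of J F0 y, OF pr cv strict])
  have "closed {z. X *v z = X *v \<beta>0 \<and> J z \<le> ereal c}"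
    by (intro closed_Collect_conj closed_sublevel[OF cl] closed_Collect_eq continuous_intros)
  moreover have "convex {z. X *v z = X *v \<beta>0 \<and> J z \<le> ereal c}"
  proof (rule convexI, clarsimp)
    fix x z u v assume *: "X *v x = X *v \<beta>0" "J x \<le> ereal c" "X *v z = X *v \<beta>0" "J z \<le> ereal c"
      "0 \<le> u" "0 \<le> v" "u + v = (1::real)"
    then have u: "u = 1 - v"
      by simp
    have "J (u *\<^sub>R x + v *\<^sub>R z) \<le> ereal c"
      using convex_fun_le[OF cv *(2,4), of v] *(5-7) unfolding u by (simp add: left_diff_distrib)
    moreover have "X *v (u *\<^sub>R x + v *\<^sub>R z) = X *v \<beta>0"
      using * by (simp add: matrix_vector_right_distrib matrix_vector_mult_scaleR flip: scaleR_add_left)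
    ultimately show "X *v (u *\<^sub>R x + v *\<^sub>R z) = X *v \<beta>0 \<and> J (u *\<^sub>R x + v *\<^sub>R z) \<le> ereal c"
      by blast
  qed
  moreover have "\<exists>t. x + t *\<^sub>R d \<notin> {z. X *v z = X *v \<beta>0 \<and> J z \<le> ereal c}" if "d \<noteq> 0" for x d
  proof (rule ccontr)
    assume "\<not> ?thesis"
    then have *: "X *v (x + t *\<^sub>R d) = X *v \<beta>0" "J (x + t *\<^sub>R d) \<le> ereal c" for t
      by auto
    have "X *v d = 0"
      using *(1)[of 0] *(1)[of 1] by (simp add: matrix_vector_right_distrib)
    moreover have "d \<in> constancy_space J"
      using bounded_line_in_constancy_space[OF cl cv *(2)] .
    ultimately show False
      using ker that by blast
  qed
  ultimately obtain \<beta> where "\<beta> extreme_point_of {z. X *v z = X *v \<beta>0 \<and> J z \<le> ereal c}"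
    using ne M by (elim extreme_point_of_line_free) auto
  then show thesis
    using that M by simp
qed

text \<open>Minimality forces the slope \<open>k\<close> to vanish, so nearby points on both sides of \<open>\<beta>\<close> are minimizers
  as well; an extreme point cannot lie between them.\<close>

lemma extreme_minimizer_no_affine_direction:
  assumes ext: "\<beta> extreme_point_of minimizers (fidelity X F0) J y"
    and X0: "X *v \<xi> = 0"
    and aff: "\<forall>\<^sub>F t in nhds 0. J (\<beta> + t *\<^sub>R \<xi>) = ereal (c + t * k)"
  shows "\<xi> = 0"
proof (rule ccontr)
  assume "\<xi> \<noteq> 0"
  obtain d where d: "d > 0" "\<And>t. \<bar>t\<bar> < d \<Longrightarrow> J (\<beta> + t *\<^sub>R \<xi>) = ereal (c + t * k)"
    using aff by (auto simp: eventually_nhds_metric dist_real_def)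
  have \<beta>: "\<beta> \<in> minimizers (fidelity X F0) J y"
    using ext by (simp add: extreme_point_of_def)
  have F: "F0 (X *v (\<beta> + t *\<^sub>R \<xi>)) y = F0 (X *v \<beta>) y" for t
    using X0 by (simp add: matrix_vector_right_distrib matrix_vector_mult_scaleR)
  have c: "J \<beta> = ereal c"
    using d(2)[of 0] d(1) by simp
  have min: "ereal (F0 (X *v \<beta>) y) + J \<beta> \<le> ereal (F0 (X *v z) y) + J z" for z
    using \<beta> by (simp add: minimizers_def fidelity_def)
  define e where "e = d / 2"
  have e: "0 < e" "e < d"
    using d(1) by (auto simp: e_def)
  have "0 \<le> e * k" "0 \<le> - e * k"
    using min[of "\<beta> + e *\<^sub>R \<xi>"] min[of "\<beta> + (- e) *\<^sub>R \<xi>"] d(2)[of e] d(2)[of "- e"] e c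
      F[of e] F[of "- e"] by simp_all
  then have "k = 0"
    using e by (simp add: mult_le_0_iff zero_le_mult_iff)
  then have "\<beta> + t *\<^sub>R \<xi> \<in> minimizers (fidelity X F0) J y" if "\<bar>t\<bar> < d" for t
    using min d(2)[OF that] c F[of t] by (simp add: minimizers_def fidelity_def)
  from this[of e] this[of "- e"]
  have "\<beta> + e *\<^sub>R \<xi> \<in> minimizers (fidelity X F0) J y" "\<beta> + (- e) *\<^sub>R \<xi> \<in> minimizers (fidelity X F0) J y"
    using e by auto
  moreover have "\<beta> = midpoint (\<beta> + e *\<^sub>R \<xi>) (\<beta> + (- e) *\<^sub>R \<xi>)"
    by (simp add: midpoint_def flip: scaleR_2)
  moreover have "\<beta> + e *\<^sub>R \<xi> \<noteq> \<beta> + (- e) *\<^sub>R \<xi>"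
    using \<open>\<xi> \<noteq> 0\<close> e by (simp add: eq_neg_iff_add_eq_0 flip: scaleR_2)
  ultimately show False
    using ext midpoint_in_open_segment unfolding extreme_point_of_def by metis
qed

section \<open>The injectivity condition at an extreme minimizer\<close>

lemma subspace_model_space: "subspace (model_space J \<beta>)"
  by (simp add: model_space_def subspace_orthogonal_comp)

text \<open>Model directions are those on which all subgradients agree. In this form every subgradient that can be exhibited yields an equation.\<close>

lemma model_space_iff:
  "h \<in> model_space J \<beta> \<longleftrightarrow> (\<forall>u\<in>subdiff J \<beta>. \<forall>v\<in>subdiff J \<beta>. u \<bullet> h = v \<bullet> h)"
proof
  assume h: "h \<in> model_space J \<beta>"
  show "\<forall>u\<in>subdiff J \<beta>. \<forall>v\<in>subdiff J \<beta>. u \<bullet> h = v \<bullet> h"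
  proof (intro ballI)
    fix u v assume "u \<in> subdiff J \<beta>" "v \<in> subdiff J \<beta>"
    then have "1 *\<^sub>R (u - v) \<in> Lin (subdiff J \<beta>)"
      unfolding Lin_def by blast
    then have "orthogonal (u - v) h"
      using h by (simp add: model_space_def orthogonal_comp_def)
    then show "u \<bullet> h = v \<bullet> h"
      by (simp add: orthogonal_def inner_diff_left)
  qed
next
  assume eq: "\<forall>u\<in>subdiff J \<beta>. \<forall>v\<in>subdiff J \<beta>. u \<bullet> h = v \<bullet> h"
  have "w \<bullet> h = 0" if wL: "w \<in> Lin (subdiff J \<beta>)" for w
  proof -
    obtain t u v where w: "w = t *\<^sub>R (u - v)" and uv: "u \<in> subdiff J \<beta>" "v \<in> subdiff J \<beta>"
      using wL unfolding Lin_def by blast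
    have "u \<bullet> h = v \<bullet> h"
      using eq uv by blast
    then show ?thesis
      by (simp add: w inner_diff_left)
  qed
  then show "h \<in> model_space J \<beta>"
    by (simp add: model_space_def orthogonal_comp_def orthogonal_def)
qed

text \<open>The hypothesis \<open>lines\<close> isolates what is required of the penalty: along a model direction it has a
  nonnegative second derivative \<open>q\<close>, and \<open>q = 0\<close> only if it is locally affine.\<close>

lemma injectivity_condition_at_extreme_minimizer:
  fixes X :: "real^'p^'n"
  assumes F: "twice_differentiable (\<lambda>\<beta>. fidelity X F0 \<beta> y)"
    and F0: "twice_differentiable (\<lambda>\<mu>. F0 \<mu> y)"
    and pd: "\<And>\<mu>. positive_definite (hess (\<lambda>\<mu>. F0 \<mu> y) \<mu>)"
    and ext: "\<beta> extreme_point_of minimizers (fidelity X F0) J y"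
    and rep: "smooth_representative J (Mf \<beta>) \<beta> Jt"
    and tangent: "\<And>\<xi> t. \<xi> \<in> model_space J \<beta> \<Longrightarrow> \<beta> + t *\<^sub>R \<xi> \<in> Mf \<beta>"
    and lines: "\<And>\<xi>. \<xi> \<in> model_space J \<beta> \<Longrightarrow> \<exists>\<phi> \<phi>' q c k.
        (\<forall>\<^sub>F t in nhds 0. J (\<beta> + t *\<^sub>R \<xi>) = ereal (\<phi> t)) \<and>
        (\<forall>\<^sub>F t in nhds 0. (\<phi> has_real_derivative \<phi>' t) (at t)) \<and>
        (\<phi>' has_real_derivative q) (at 0) \<and> q \<ge> 0 \<and>
        (q = 0 \<longrightarrow> (\<forall>\<^sub>F t in nhds 0. \<phi> t = c + t * k))"
  shows "injectivity_condition (fidelity X F0) J Mf \<beta> y"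
  unfolding injectivity_condition_def
proof (intro conjI allI impI ballI)
  show "\<exists>Jt. smooth_representative J (Mf \<beta>) \<beta> Jt"
    using rep by blast
next
  fix Jt \<xi>
  assume rep: "smooth_representative J (Mf \<beta>) \<beta> Jt" and \<xi>: "\<xi> \<in> model_space J \<beta>" "\<xi> \<noteq> 0"
  obtain \<phi> \<phi>' q c k where
    \<phi>: "\<forall>\<^sub>F t in nhds 0. J (\<beta> + t *\<^sub>R \<xi>) = ereal (\<phi> t)"
       "\<forall>\<^sub>F t in nhds 0. (\<phi> has_real_derivative \<phi>' t) (at t)"
       "(\<phi>' has_real_derivative q) (at 0)" "q \<ge> 0"
    and aff: "q = 0 \<Longrightarrow> \<forall>\<^sub>F t in nhds 0. \<phi> t = c + t * k"
    using lines[OF \<xi>(1)] by blast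
  have Jt: "C2 Jt" "\<forall>\<^sub>F x in nhds \<beta>. x \<in> Mf \<beta> \<longrightarrow> J x = ereal (Jt x)"
    using rep by (auto simp: smooth_representative_def)
  have "\<forall>\<^sub>F t in nhds 0. Jt (\<beta> + t *\<^sub>R \<xi>) = \<phi> t"
    using eventually_along_line[OF Jt(2), of \<xi>] \<phi>(1)
    by eventually_elim (use tangent[OF \<xi>(1)] in simp)
  then have qJ: "(hess Jt \<beta> *v \<xi>) \<bullet> \<xi> = q"
    using Jt(1) \<phi>(2,3) by (intro hess_quadratic_form_along_line) (auto simp: C2_def)
  have qF: "(hess (\<lambda>b. fidelity X F0 b y) \<beta> *v \<xi>) \<bullet> \<xi>
      = (hess (\<lambda>\<mu>. F0 \<mu> y) (X *v \<beta>) *v (X *v \<xi>)) \<bullet> (X *v \<xi>)" (is "?F = _")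
    by (rule hess_fidelity_quadratic_form[OF F F0])
  have "?F + q > 0"
  proof (cases "X *v \<xi> = 0")
    case False
    then show ?thesis
      using pd[of "X *v \<beta>"] \<phi>(4) by (simp add: qF positive_definite_def add_pos_nonneg)
  next
    case True
    have "q \<noteq> 0"
    proof
      assume "q = 0"
      have "\<forall>\<^sub>F t in nhds 0. J (\<beta> + t *\<^sub>R \<xi>) = ereal (c + t * k)"
        using \<phi>(1) aff[OF \<open>q = 0\<close>] by eventually_elim simp
      then show False
        using extreme_minimizer_no_affine_direction[of \<beta> X F0 J y, OF ext True] \<xi>(2) by blast
    qed
    then show ?thesis
      using \<phi>(4) by (simp add: qF True)
  qed
  then show "(riemannian_hess (model_space J \<beta>) (\<lambda>b. fidelity X F0 b y) \<beta> \<xi>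
            + riemannian_hess (model_space J \<beta>) Jt \<beta> \<xi>) \<bullet> \<xi> > 0"
    by (simp add: inner_add_left riemannian_hess_inner[OF subspace_model_space \<xi>(1)] qJ)
qed

lemma non_injectivity_set_emptyI:
  fixes X :: "real^'p^'n"
  assumes pr: "proper_fun J" and cv: "convex_fun J" and cl: "closed (epi J)"
    and F0: "\<And>y. twice_differentiable (\<lambda>\<mu>. F0 \<mu> y)"
    and pd: "\<And>\<mu> y. positive_definite (hess (\<lambda>m. F0 m y) \<mu>)"
    and ker: "{h. X *v h = 0} \<inter> constancy_space J = {0}"
    and ext: "\<And>y \<beta> c. \<beta> extreme_point_of minimizers (fidelity X F0) J y \<Longrightarrow> J \<beta> = ereal c \<Longrightarrow>
        injectivity_condition (fidelity X F0) J Mf \<beta> y"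
  shows "non_injectivity_set (fidelity X F0) J Mf = {}"
proof -
  have "\<exists>\<beta>\<in>minimizers (fidelity X F0) J y. injectivity_condition (fidelity X F0) J Mf \<beta> y"
    if ne: "minimizers (fidelity X F0) J y \<noteq> {}" for y
  proof -
    have strict: "midpoint_strictly_convex (\<lambda>\<mu>. F0 \<mu> y)"
      using F0 pd by (rule midpoint_strictly_convex_posdef)
    obtain \<beta> where \<beta>: "\<beta> extreme_point_of minimizers (fidelity X F0) J y"
      using extreme_minimizer[of J F0 y X, OF pr cv cl strict ker ne] .
    then have min: "\<beta> \<in> minimizers (fidelity X F0) J y"
      by (simp add: extreme_point_of_def)
    obtain c where "J \<beta> = ereal c"
      using minimizers_eq_sublevel[of J F0 y \<beta> X, OF pr cv strict min] .
    then show ?thesis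
      using ext[OF \<beta>] min by blast
  qed
  then show ?thesis
    unfolding non_injectivity_set_def by blast
qed

section \<open>Polyhedral penalties\<close>

text \<open>Near \<open>(\<beta>, c)\<close> the epigraph coincides with the cone of its active constraints, since the finitely
  many inactive ones hold strictly there and so remain valid nearby. The set \<open>N\<close> consists of the
  normals of the active constraints.\<close>

lemma polyhedral_local_constraints:
  fixes J :: "'a::euclidean_space \<Rightarrow> ereal"
  assumes "polyhedral_fun J" and J: "J \<beta> = ereal c"
  obtains N :: "('a \<times> real) set" where
    "\<forall>(a, s)\<in>N. \<forall>z r. J z \<le> ereal r \<longrightarrow> a \<bullet> (z - \<beta>) + s * (r - c) \<le> 0"
    "\<forall>\<^sub>F p in nhds (\<beta>, c). (\<forall>(a, s)\<in>N. a \<bullet> (fst p - \<beta>) + s * (snd p - c) \<le> 0)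
        \<longrightarrow> J (fst p) \<le> ereal (snd p)"
proof -
  obtain G where G: "finite G" "epi J = \<Inter>G" "\<forall>h\<in>G. \<exists>a b. a \<noteq> 0 \<and> h = {p. a \<bullet> p \<le> b}"
    using assms(1)[unfolded polyhedral_fun_def polyhedron_def] by (elim exE conjE)
  have "\<exists>ab. \<forall>p. p \<in> h \<longleftrightarrow> fst ab \<bullet> p \<le> snd ab" if "h \<in> G" for h
  proof -
    obtain a b where "h = {p. a \<bullet> p \<le> b}"
      using bspec[OF G(3) \<open>h \<in> G\<close>] by (elim exE conjE)
    then show ?thesis
      by (intro exI[of _ "(a, b)"]) simp
  qed
  then have halfspaces: "\<forall>h\<in>G. \<exists>ab. \<forall>p. p \<in> h \<longleftrightarrow> fst ab \<bullet> p \<le> snd ab"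
    by (rule ballI)
  obtain ab where ab: "\<forall>h\<in>G. \<forall>p. p \<in> h \<longleftrightarrow> fst (ab h) \<bullet> p \<le> snd (ab h)"
    using bchoice[OF halfspaces] by (elim exE)
  define A b where "A h = fst (ab h)" and "b h = snd (ab h)" for h
  have epi: "J z \<le> ereal r \<longleftrightarrow> (\<forall>h\<in>G. A h \<bullet> (z, r) \<le> b h)" for z r
  proof -
    have "J z \<le> ereal r \<longleftrightarrow> (z, r) \<in> \<Inter>G"
      unfolding G(2)[symmetric] by (simp add: epi_def)
    then show ?thesis
      using ab by (simp add: A_def b_def)
  qed
  define act where "act = {h \<in> G. A h \<bullet> (\<beta>, c) = b h}"
  have diff: "fst a \<bullet> (z - \<beta>) + snd a * (r - c) = a \<bullet> (z, r) - a \<bullet> (\<beta>, c)" for a :: "'a \<times> real" and z r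
    by (cases a) (simp add: algebra_simps)
  have inactive: "\<forall>\<^sub>F p in nhds (\<beta>, c). \<forall>h\<in>G - act. A h \<bullet> p < b h"
  proof (intro eventually_ball_finite ballI)
    fix h assume h: "h \<in> G - act"
    then have "A h \<bullet> (\<beta>, c) < b h"
      using epi[of \<beta> c] J by (force simp: act_def)
    moreover have "open {p. A h \<bullet> p < b h}"
      by (rule open_halfspace_lt)
    ultimately show "\<forall>\<^sub>F p in nhds (\<beta>, c). A h \<bullet> p < b h"
      using eventually_nhds_in_open[of "{p. A h \<bullet> p < b h}"] by simp
  qed (use G(1) in auto)
  show thesis
  proof (rule that[of "A ` act"])
    have "a \<bullet> (z - \<beta>) + s * (r - c) \<le> 0"
      if as: "(a, s) \<in> A ` act" and z: "J z \<le> ereal r" for a s z r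
    proof -
      obtain h where h: "h \<in> G" "(a, s) = A h" "A h \<bullet> (\<beta>, c) = b h"
        using as by (auto simp: act_def)
      moreover have "A h \<bullet> (z, r) \<le> b h"
        using z h(1) unfolding epi by blast
      ultimately have "(a, s) \<bullet> (z, r) \<le> (a, s) \<bullet> (\<beta>, c)"
        by metis
      then show ?thesis
        using diff[of "(a, s)" z r] by simp
    qed
    then show "\<forall>(a, s)\<in>A ` act. \<forall>z r. J z \<le> ereal r \<longrightarrow> a \<bullet> (z - \<beta>) + s * (r - c) \<le> 0"
      by blast
  next
    show "\<forall>\<^sub>F p in nhds (\<beta>, c). (\<forall>(a, s)\<in>A ` act. a \<bullet> (fst p - \<beta>) + s * (snd p - c) \<le> 0)
        \<longrightarrow> J (fst p) \<le> ereal (snd p)"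
      using inactive
    proof eventually_elim
      case (elim p)
      show ?case
      proof
        assume *: "\<forall>(a, s)\<in>A ` act. a \<bullet> (fst p - \<beta>) + s * (snd p - c) \<le> 0"
        have "A h \<bullet> p \<le> b h" if "h \<in> G" for h
        proof (cases "h \<in> act")
          case True
          then show ?thesis
            using * diff[of "A h" "fst p" "snd p"] by (force simp: act_def)
        next
          case False
          then show ?thesis
            using elim that by (auto intro: less_imp_le)
        qed
        then show "J (fst p) \<le> ereal (snd p)"
          using epi by simp
      qed
    qed
  qed
qed

text \<open>An active normal \<open>(a, s)\<close> has \<open>s \<le> 0\<close>. If \<open>s < 0\<close> then \<open>- a / s\<close> is a subgradient, and if \<open>s = 0\<close>
  then \<open>a\<close> may be added to any subgradient \<open>u\<close>. As all subgradients agree on \<open>T\<^sub>\<beta>\<close>, either way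
  \<open>a \<bullet> h + s (u \<bullet> h) = 0\<close> for \<open>h \<in> T\<^sub>\<beta>\<close>: a small step to \<open>(\<beta> + h, c + u \<bullet> h)\<close> keeps all active
  constraints tight and so stays in the epigraph. The opposite inequality is that of the subgradient \<open>u\<close>.\<close>

lemma polyhedral_affine_on_model_space:
  fixes J :: "'a::euclidean_space \<Rightarrow> ereal"
  assumes pr: "proper_fun J" and poly: "polyhedral_fun J" and J: "J \<beta> = ereal c"
  obtains u where "\<forall>\<^sub>F x in nhds \<beta>. x - \<beta> \<in> model_space J \<beta> \<longrightarrow> J x = ereal (c + u \<bullet> (x - \<beta>))"
proof -
  obtain N where N': "\<forall>(a, s)\<in>N. \<forall>z r. J z \<le> ereal r \<longrightarrow> a \<bullet> (z - \<beta>) + s * (r - c) \<le> 0"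
    and local: "\<forall>\<^sub>F p in nhds (\<beta>, c). (\<forall>(a, s)\<in>N. a \<bullet> (fst p - \<beta>) + s * (snd p - c) \<le> 0)
        \<longrightarrow> J (fst p) \<le> ereal (snd p)"
    using polyhedral_local_constraints[of J \<beta> c, OF poly J] .
  have N: "a \<bullet> (z - \<beta>) + s * (r - c) \<le> 0" if "(a, s) \<in> N" "J z \<le> ereal r" for a s z r
    using N' that by blast
  have subdiffI: "u \<in> subdiff J \<beta>" if "\<And>z r. J z = ereal r \<Longrightarrow> u \<bullet> (z - \<beta>) \<le> r - c" for u
  proof -
    have "J \<beta> + ereal (u \<bullet> (z - \<beta>)) \<le> J z" for z
      using that[of z] pr J by (cases "J z") (auto simp: proper_fun_def)
    then show ?thesis
      by (simp add: subdiff_def)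
  qed
  have sgn: "s \<le> 0" if "(a, s) \<in> N" for a s
    using N[OF that, of \<beta> "c + 1"] J by simp
  have steep: "(1 / (- s)) *\<^sub>R a \<in> subdiff J \<beta>" if "(a, s) \<in> N" "s < 0" for a s
  proof (rule subdiffI)
    fix z r assume "J z = ereal r"
    then show "((1 / (- s)) *\<^sub>R a) \<bullet> (z - \<beta>) \<le> r - c"
      using N[OF that(1), of z r] that(2) by (simp add: field_simps)
  qed
  \<comment> \<open>If all active constraints were vertical, the epigraph would extend below \<open>(\<beta>, J \<beta>)\<close>.\<close>
  have "\<exists>(a, s)\<in>N. s < 0"
  proof (rule ccontr)
    assume "\<not> ?thesis"
    then have zero: "s = 0" if "(a, s) \<in> N" for a s
      using that sgn by fastforce
    have "((\<lambda>t. (\<beta>, c - t)) \<longlongrightarrow> (\<beta>, c - 0)) (at_right 0)"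
      by (intro tendsto_intros)
    then have "\<forall>\<^sub>F t in at_right 0. (\<forall>(a, s)\<in>N. a \<bullet> (\<beta> - \<beta>) + s * ((c - t) - c) \<le> 0)
        \<longrightarrow> J \<beta> \<le> ereal (c - t)"
      using eventually_compose_filterlim[OF local, of "\<lambda>t. (\<beta>, c - t)" "at_right 0"] by simp
    then have "\<forall>\<^sub>F t in at_right 0. J \<beta> \<le> ereal (c - t)"
      by eventually_elim (use zero in force)
    moreover have "\<forall>\<^sub>F t in at_right 0. (0::real) < t"
      by (rule eventually_at_right_less)
    ultimately have "\<forall>\<^sub>F t in at_right (0::real). False"
      by eventually_elim (simp add: J)
    then show False
      by simp
  qed
  then obtain a0 s0 where "(a0, s0) \<in> N" "s0 < 0"
    by auto
  then obtain u where u: "u \<in> subdiff J \<beta>"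
    using steep by blast
  have tight: "a \<bullet> h + s * (u \<bullet> h) = 0" if as: "(a, s) \<in> N" and h: "h \<in> model_space J \<beta>" for a s h
  proof (cases "s = 0")
    case True
    have "u + a \<in> subdiff J \<beta>"
    proof (rule subdiffI)
      fix z r assume z: "J z = ereal r"
      have "J \<beta> + ereal (u \<bullet> (z - \<beta>)) \<le> J z"
        using u by (simp add: subdiff_def)
      then show "(u + a) \<bullet> (z - \<beta>) \<le> r - c"
        using N[OF as, of z r] z True J by (simp add: inner_add_left)
    qed
    then have "(u + a) \<bullet> h = u \<bullet> h"
      using h u unfolding model_space_iff by blast
    then show ?thesis
      using True by (simp add: inner_add_left)
  next
    case False
    then have "s < 0"
      using sgn[OF as] by simp
    moreover have "((1 / (- s)) *\<^sub>R a) \<bullet> h = u \<bullet> h"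
      using h u steep[OF as \<open>s < 0\<close>] unfolding model_space_iff by blast
    ultimately show ?thesis
      by (simp add: field_simps)
  qed
  have "((\<lambda>x. (x, c + u \<bullet> (x - \<beta>))) \<longlongrightarrow> (\<beta>, c + u \<bullet> (\<beta> - \<beta>))) (nhds \<beta>)"
    by (intro tendsto_intros filterlim_ident)
  then have "\<forall>\<^sub>F x in nhds \<beta>. (\<forall>(a, s)\<in>N. a \<bullet> (x - \<beta>) + s * (u \<bullet> (x - \<beta>)) \<le> 0)
      \<longrightarrow> J x \<le> ereal (c + u \<bullet> (x - \<beta>))"
    using eventually_compose_filterlim[OF local, of "\<lambda>x. (x, c + u \<bullet> (x - \<beta>))" "nhds \<beta>"] by simp
  then have "\<forall>\<^sub>F x in nhds \<beta>. x - \<beta> \<in> model_space J \<beta> \<longrightarrow> J x = ereal (c + u \<bullet> (x - \<beta>))"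
  proof eventually_elim
    case (elim x)
    show ?case
    proof
      assume "x - \<beta> \<in> model_space J \<beta>"
      then have "J x \<le> ereal (c + u \<bullet> (x - \<beta>))"
        using elim tight by force
      moreover have "J \<beta> + ereal (u \<bullet> (x - \<beta>)) \<le> J x"
        using u by (simp add: subdiff_def)
      ultimately show "J x = ereal (c + u \<bullet> (x - \<beta>))"
        using J by (simp add: order_antisym)
    qed
  qed
  then show thesis
    by (rule that)
qed

lemma non_injectivity_set_polyhedral:
  fixes X :: "real^'p^'n"
  assumes pr: "proper_fun J" and poly: "polyhedral_fun J"
    and F: "\<And>y. twice_differentiable (\<lambda>\<beta>. fidelity X F0 \<beta> y)"
    and F0: "\<And>y. twice_differentiable (\<lambda>\<mu>. F0 \<mu> y)"
    and pd: "\<And>\<mu> y. positive_definite (hess (\<lambda>m. F0 m y) \<mu>)"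
    and ker: "{h. X *v h = 0} \<inter> constancy_space J = {0}"
  shows "non_injectivity_set (fidelity X F0) J (affine_manifold J) = {}"
proof (rule non_injectivity_set_emptyI[OF pr _ _ F0 pd ker])
  show "convex_fun J" "closed (epi J)"
    using poly polyhedron_imp_convex polyhedron_imp_closed
    by (auto simp: convex_fun_def polyhedral_fun_def)
next
  fix y \<beta> c
  assume \<beta>: "\<beta> extreme_point_of minimizers (fidelity X F0) J y" and c: "J \<beta> = ereal c"
  obtain u where u: "\<forall>\<^sub>F x in nhds \<beta>. x - \<beta> \<in> model_space J \<beta> \<longrightarrow> J x = ereal (c + u \<bullet> (x - \<beta>))"
    using polyhedral_affine_on_model_space[OF pr poly c] .
  show "injectivity_condition (fidelity X F0) J (affine_manifold J) \<beta> y"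
  proof (rule injectivity_condition_at_extreme_minimizer[of X F0 y \<beta> J, OF F F0 pd \<beta>])
    show "smooth_representative J (affine_manifold J \<beta>) \<beta> (\<lambda>x. (c - u \<bullet> \<beta>) + u \<bullet> x)"
      unfolding smooth_representative_def
    proof (intro conjI C2_affine)
      show "\<forall>\<^sub>F x in nhds \<beta>. x \<in> affine_manifold J \<beta> \<longrightarrow> J x = ereal (c - u \<bullet> \<beta> + u \<bullet> x)"
        using u by eventually_elim (auto simp: affine_manifold_def inner_diff_right algebra_simps)
    qed
  next
    fix \<xi> and t :: real assume \<xi>: "\<xi> \<in> model_space J \<beta>"
    then show "\<beta> + t *\<^sub>R \<xi> \<in> affine_manifold J \<beta>"
      using subspace_scale[OF subspace_model_space \<xi>] by (auto simp: affine_manifold_def)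
  next
    fix \<xi> assume \<xi>: "\<xi> \<in> model_space J \<beta>"
    have "\<forall>\<^sub>F t in nhds 0. J (\<beta> + t *\<^sub>R \<xi>) = ereal (c + t * (u \<bullet> \<xi>))"
      using eventually_along_line[OF u, of \<xi>]
      by eventually_elim (use subspace_scale[OF subspace_model_space \<xi>] in simp)
    moreover have "((\<lambda>t. c + t * (u \<bullet> \<xi>)) has_real_derivative u \<bullet> \<xi>) (at t)" for t
      by (auto intro!: derivative_eq_intros)
    moreover have "((\<lambda>t::real. u \<bullet> \<xi>) has_real_derivative 0) (at 0)"
      by simp
    ultimately show "\<exists>\<phi> \<phi>' q c k.
        (\<forall>\<^sub>F t in nhds 0. J (\<beta> + t *\<^sub>R \<xi>) = ereal (\<phi> t)) \<and>
        (\<forall>\<^sub>F t in nhds 0. (\<phi> has_real_derivative \<phi>' t) (at t)) \<and>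
        (\<phi>' has_real_derivative q) (at 0) \<and> q \<ge> 0 \<and>
        (q = 0 \<longrightarrow> (\<forall>\<^sub>F t in nhds 0. \<phi> t = c + t * k))"
      by (intro exI[of _ "\<lambda>t. c + t * (u \<bullet> \<xi>)"] exI[of _ "\<lambda>t. u \<bullet> \<xi>"] exI[of _ 0]
          exI[of _ c] exI[of _ "u \<bullet> \<xi>"] conjI) auto
  qed
qed

text \<open>The norm is the maximum of the finitely many linear functions given by sign vectors.\<close>

lemma polyhedral_general_lasso:
  fixes D :: "real^'q^'p"
  shows "polyhedral_fun (general_lasso D)"
proof -
  define \<sigma> where "\<sigma> I = (\<chi> i. if i \<in> I then 1 else - (1::real))" for I :: "'q set"
  have l1: "(\<Sum>i\<in>UNIV. \<bar>v $ i\<bar>) \<le> r \<longleftrightarrow> (\<forall>I. \<sigma> I \<bullet> v \<le> r)" for v :: "real^'q" and r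
  proof
    have "\<sigma> I \<bullet> v \<le> (\<Sum>i\<in>UNIV. \<bar>v $ i\<bar>)" for I
      unfolding inner_vec_def by (intro sum_mono) (auto simp: \<sigma>_def)
    then show "(\<Sum>i\<in>UNIV. \<bar>v $ i\<bar>) \<le> r \<Longrightarrow> \<forall>I. \<sigma> I \<bullet> v \<le> r"
      by (meson order_trans)
  next
    have "\<sigma> {i. v $ i \<ge> 0} \<bullet> v = (\<Sum>i\<in>UNIV. \<bar>v $ i\<bar>)"
      unfolding inner_vec_def by (intro sum.cong) (auto simp: \<sigma>_def)
    then show "\<forall>I. \<sigma> I \<bullet> v \<le> r \<Longrightarrow> (\<Sum>i\<in>UNIV. \<bar>v $ i\<bar>) \<le> r"
      by metis
  qed
  have adj: "\<sigma> I \<bullet> (x v* D) = (D *v \<sigma> I) \<bullet> x" for I x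
    by (metis dot_lmul_matrix inner_commute)
  have "epi (general_lasso D) = (\<Inter>I. {p. (D *v \<sigma> I, - 1) \<bullet> p \<le> 0})"
    using l1 by (auto simp: epi_def general_lasso_def lasso_def adj)
  then show ?thesis
    unfolding polyhedral_fun_def by (auto intro!: polyhedron_Inter simp: polyhedron_halfspace_le)
qed

lemma lasso_eq_general_lasso: "lasso = general_lasso (mat 1)"
  by (simp add: fun_eq_iff general_lasso_def transpose_mat)

lemma polyhedral_linf: "polyhedral_fun (linf_penalty :: real^'p \<Rightarrow> ereal)"
proof -
  have le: "infnorm x \<le> r \<longleftrightarrow> (\<forall>b\<in>Basis. \<bar>x \<bullet> b\<bar> \<le> r)" for x :: "real^'p" and r
    unfolding infnorm_Max by (subst Max_le_iff) auto
  have "epi (linf_penalty :: real^'p \<Rightarrow> ereal) =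
      (\<Inter>b\<in>Basis. {p. (b, - 1) \<bullet> p \<le> 0} \<inter> {p. (- b, - 1) \<bullet> p \<le> 0})"
    by (auto simp: epi_def linf_penalty_def le abs_le_iff inner_commute)
  then show ?thesis
    by (simp add: polyhedral_fun_def)
       (intro polyhedron_Inter, auto intro!: polyhedron_Int simp: polyhedron_halfspace_le)
qed

lemma constancy_space_trivial:
  assumes "\<And>h. J h = J 0 \<Longrightarrow> h = 0"
  shows "constancy_space J = {0}"
proof -
  have "h = 0" if "h \<in> constancy_space J" for h
    using that assms[of h] by (force simp: constancy_space_def dest: spec[of _ 0] spec[of _ 1])
  moreover have "0 \<in> constancy_space J"
    by (simp add: constancy_space_def)
  ultimately show ?thesis
    by blast
qed

section \<open>The Euclidean norm away from the origin\<close>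

text \<open>Powers of the positive part, from the square on, are differentiable also at 0; they serve as cutoff
  functions.\<close>

lemma DERIV_max_power:
  "((\<lambda>x. max 0 x ^ Suc (Suc n)) has_real_derivative real (Suc (Suc n)) * max 0 x ^ Suc n) (at x)"
proof -
  consider "x < 0" | "x > 0" | "x = 0"
    by linarith
  then show ?thesis
  proof cases
    case 1
    have "((\<lambda>x::real. 0) has_real_derivative 0) (at x)"
      by simp
    moreover have "\<forall>\<^sub>F z in nhds x. 0 = max 0 z ^ Suc (Suc n)"
      using eventually_nhds_in_open[of "{..<0}" x] 1 by (auto elim!: eventually_mono)
    ultimately show ?thesis
      using 1 DERIV_cong_ev[of x x "\<lambda>x. 0" "\<lambda>x. max 0 x ^ Suc (Suc n)" 0 0] by simp
  next
    case 2
    have "((\<lambda>x::real. x ^ Suc (Suc n)) has_real_derivative real (Suc (Suc n)) * x ^ Suc n) (at x)"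
      using DERIV_pow[of "Suc (Suc n)" x] by simp
    moreover have "\<forall>\<^sub>F z in nhds x. z ^ Suc (Suc n) = max 0 z ^ Suc (Suc n)"
      using eventually_nhds_in_open[of "{0<..}" x] 2 by (auto elim!: eventually_mono)
    ultimately show ?thesis
      using 2 DERIV_cong_ev[of x x "\<lambda>x. x ^ Suc (Suc n)" "\<lambda>x. max 0 x ^ Suc (Suc n)"] by simp
  next
    case 3
    have "((\<lambda>h::real. max 0 h ^ Suc n) \<longlongrightarrow> max 0 0 ^ Suc n) (at 0)"
      by (intro tendsto_intros)
    moreover have "max 0 h ^ Suc n = (max 0 (0 + h) ^ Suc (Suc n) - max 0 0 ^ Suc (Suc n)) / h"
      if "h \<noteq> 0" for h :: real
      using that by (cases "h > 0") auto
    ultimately have "((\<lambda>h::real. (max 0 (0 + h) ^ Suc (Suc n) - max 0 0 ^ Suc (Suc n)) / h) \<longlongrightarrow> 0) (at 0)"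
      by (subst tendsto_cong[where g = "\<lambda>h. max 0 h ^ Suc n"])
         (auto simp: eventually_at_filter)
    then show ?thesis
      using 3 by (simp add: DERIV_def)
  qed
qed

text \<open>The argument \<open>r\<close> is replaced by \<open>\<phi> r = r + (max 0 (a - r))\<^sup>3 / a\<^sup>2\<close>. This changes nothing for
  \<open>r \<ge> a\<close>; the cube keeps two continuous derivatives at \<open>r = a\<close>, and \<open>\<phi>\<close> is positive on the whole line,
  so that its square root is \<open>C\<^sup>2\<close>.\<close>

lemma smooth_extension_of_sqrt:
  fixes a :: real
  assumes a: "a > 0"
  obtains s s' s'' where
    "\<forall>r. (s has_real_derivative s' r) (at r)"
    "\<forall>r. (s' has_real_derivative s'' r) (at r)"
    "continuous_on UNIV s''"
    "\<forall>r\<ge>a. s r = sqrt r"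
proof -
  define m where "m r = max 0 (a - r)" for r
  define \<phi> where "\<phi> r = r + m r ^ 3 / a\<^sup>2" for r
  define \<phi>' where "\<phi>' r = 1 - 3 * m r ^ 2 / a\<^sup>2" for r
  define \<phi>'' where "\<phi>'' r = 6 * m r / a\<^sup>2" for r
  have m_pow: "((\<lambda>r. m r ^ Suc (Suc n)) has_real_derivative - (real (Suc (Suc n)) * m r ^ Suc n)) (at r)"
    for n r
  proof -
    have "((\<lambda>r. a - r) has_real_derivative - 1) (at r)"
      by (auto intro!: derivative_eq_intros)
    from DERIV_chain2[where f = "\<lambda>x. max 0 x ^ Suc (Suc n)" and g = "\<lambda>r. a - r", OF DERIV_max_power this]
    show ?thesis
      by (simp add: m_def)
  qed
  have d3: "((\<lambda>r. m r ^ 3) has_real_derivative - (3 * m r ^ 2)) (at r)" for r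
    using m_pow[of 1 r] by (simp add: numeral_3_eq_3 numeral_2_eq_2)
  have d2: "((\<lambda>r. m r ^ 2) has_real_derivative - (2 * m r)) (at r)" for r
    using m_pow[of 0 r] by (simp add: numeral_2_eq_2)
  have \<phi>: "(\<phi> has_real_derivative \<phi>' r) (at r)" for r
    using DERIV_add[OF DERIV_ident DERIV_cdivide[OF d3[of r], where c = "a\<^sup>2"]]
    by (simp add: \<phi>_def[abs_def] \<phi>'_def)
  have \<phi>': "(\<phi>' has_real_derivative \<phi>'' r) (at r)" for r
    using DERIV_diff[OF DERIV_const[where k = 1] DERIV_cdivide[OF DERIV_cmult[OF d2[of r], where c = 3], where c = "a\<^sup>2"]]
    by (simp add: \<phi>'_def[abs_def] \<phi>''_def)
  have pos: "\<phi> r > 0" for r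
  proof (cases "r \<ge> a")
    case True
    then show ?thesis
      using a by (simp add: \<phi>_def m_def)
  next
    case False
    define u where "u = (a - r) / a"
    have u: "u > 0" "r = a * (1 - u)" "m r = a * u"
      using False a by (auto simp: u_def m_def field_simps)
    \<comment> \<open>In the scaled variable, positivity of \<open>\<phi>\<close> is positivity of this cubic for \<open>u > 0\<close>.\<close>
    have "1 - u + u ^ 3 > 0"
    proof (cases "u < 1")
      case True
      then show ?thesis
        using u(1) by (simp add: add_pos_pos)
    next
      case False
      then have "u ^ 1 \<le> u ^ 3"
        by (intro power_increasing) auto
      then show ?thesis
        by simp
    qed
    moreover have "\<phi> r = a * (1 - u + u ^ 3)"
      using a unfolding \<phi>_def u(3) by (subst u(2)) (simp add: field_simps power2_eq_square power3_eq_cube)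
    ultimately show ?thesis
      using a by simp
  qed
  define s where "s r = sqrt (\<phi> r)" for r
  define s' where "s' r = \<phi>' r / (2 * s r)" for r
  define s'' where "s'' r = (\<phi>'' r * (2 * s r) - \<phi>' r * (2 * s' r)) / (2 * s r * (2 * s r))" for r
  have s_pos: "s r > 0" for r
    using pos by (simp add: s_def)
  have s: "(s has_real_derivative s' r) (at r)" for r
    unfolding s_def[abs_def]
    by (rule DERIV_cong, rule DERIV_chain2[where f = sqrt and g = \<phi> and x = r, OF DERIV_real_sqrt[OF pos] \<phi>])
       (simp add: s'_def s_def field_simps)
  have "((\<lambda>r. \<phi>' r / (2 * s r)) has_real_derivative s'' r) (at r)" for r
    unfolding s''_def using s_pos[of r] by (intro DERIV_divide \<phi>' DERIV_cmult s) simp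
  moreover have "s' = (\<lambda>r. \<phi>' r / (2 * s r))"
    by (simp add: s'_def fun_eq_iff)
  ultimately have s': "(s' has_real_derivative s'' r) (at r)" for r
    by simp
  have "continuous_on UNIV s" "continuous_on UNIV s'" "continuous_on UNIV \<phi>'"
    using s s' \<phi>' by (meson DERIV_isCont continuous_at_imp_continuous_on)+
  moreover have "continuous_on UNIV \<phi>''"
    unfolding \<phi>''_def m_def using a by (intro continuous_intros) auto
  ultimately have "continuous_on UNIV s''"
    unfolding s''_def using s_pos by (intro continuous_intros) (auto simp: less_imp_neq[symmetric])
  moreover have "\<forall>r\<ge>a. s r = sqrt r"
    by (simp add: s_def \<phi>_def m_def)
  ultimately show thesis
    using that[of s s' s''] s s' by simp
qed

lemma C2_compose_square_norm:
  fixes A :: "real^'p^'m"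
  assumes s: "\<And>r. (s has_real_derivative s' r) (at r)"
    and s': "\<And>r. (s' has_real_derivative s'' r) (at r)"
    and cont: "continuous_on UNIV s''"
  shows "C2 (\<lambda>x. s ((A *v x) \<bullet> (A *v x)))"
proof -
  define n where "n x = (A *v x) \<bullet> (A *v x)" for x
  define u where "u x = (transpose A ** A) *v x" for x
  \<comment> \<open>\<open>P\<close> is the outer product of \<open>u\<close> with itself and \<open>H\<close> the Hessian given by the chain rule; the gradient of \<open>n\<close> is \<open>2 u\<close>.\<close>
  define P where "P x = (\<chi> i j. u x $ i * u x $ j)" for x
  define H where "H x = (4 * s'' (n x)) *\<^sub>R P x + (2 * s' (n x)) *\<^sub>R (transpose A ** A)" for x
  have P: "P x *v h = (h \<bullet> u x) *\<^sub>R u x" for x h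
    by (simp add: P_def vec_eq_iff matrix_vector_mult_def inner_vec_def sum_distrib_left mult_ac)
  have "u = (*v) (transpose A ** A)"
    by (simp add: u_def fun_eq_iff)
  then have u_lin: "(u has_derivative u) (at x)" for x
    using bounded_linear_imp_has_derivative[OF matrix_vector_mul_bounded_linear] by simp
  have A_lin: "((*v) A has_derivative (*v) A) (at x)" for x
    by (rule bounded_linear_imp_has_derivative[OF matrix_vector_mul_bounded_linear])
  have n_deriv: "GDERIV n x :> 2 *\<^sub>R u x" for x
  proof -
    have "(A *v x) \<bullet> (A *v h) = h \<bullet> u x" for h
      by (simp add: u_def inner_commute[of h] dot_lmul_matrix flip: matrix_vector_mul_assoc)
    then have "(A *v x) \<bullet> (A *v h) + (A *v h) \<bullet> (A *v x) = h \<bullet> (2 *\<^sub>R u x)" for h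
      by (simp add: inner_commute)
    then show ?thesis
      using has_derivative_inner[OF A_lin[of x] A_lin[of x]] by (simp add: gderiv_def n_def[abs_def])
  qed
  have "C2 (\<lambda>x. s (n x))"
  proof (rule C2I)
    show "GDERIV (\<lambda>x. s (n x)) x :> s' (n x) *\<^sub>R 2 *\<^sub>R u x" for x
      by (rule GDERIV_DERIV_compose[OF n_deriv s])
    show "((\<lambda>x. s' (n x) *\<^sub>R 2 *\<^sub>R u x) has_derivative (\<lambda>h. H x *v h)) (at x)" for x
    proof -
      have "GDERIV (\<lambda>x. s' (n x)) x :> s'' (n x) *\<^sub>R 2 *\<^sub>R u x"
        by (rule GDERIV_DERIV_compose[OF n_deriv s'])
      from has_derivative_scaleR[OF this[unfolded gderiv_def] has_derivative_scaleR_right[OF u_lin, where r = 2]]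
      have "((\<lambda>x. s' (n x) *\<^sub>R 2 *\<^sub>R u x) has_derivative
          (\<lambda>h. s' (n x) *\<^sub>R 2 *\<^sub>R u h + (h \<bullet> (s'' (n x) *\<^sub>R 2 *\<^sub>R u x)) *\<^sub>R 2 *\<^sub>R u x)) (at x)" .
      moreover have "s' (n x) *\<^sub>R 2 *\<^sub>R u h + (h \<bullet> (s'' (n x) *\<^sub>R 2 *\<^sub>R u x)) *\<^sub>R 2 *\<^sub>R u x = H x *v h" for h
        by (simp add: H_def u_def[of h] matrix_vector_mult_add_rdistrib P mult_ac flip: scaleR_matrix_vector_assoc)
      ultimately show ?thesis
        by (simp only:)
    qed
    have n: "continuous_on UNIV n" and u: "continuous_on UNIV u"
      unfolding n_def u_def by (intro continuous_intros)+
    have "continuous_on UNIV s'"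
      using s' DERIV_isCont by (auto simp: continuous_on_eq_continuous_at)
    then have "continuous_on UNIV (\<lambda>x. s' (n x))"
      using n by (rule continuous_on_compose2) simp
    moreover have "continuous_on UNIV (\<lambda>x. s'' (n x))"
      using cont n by (rule continuous_on_compose2) simp
    moreover have "continuous_on UNIV P"
      unfolding P_def by (intro continuous_intros u)
    ultimately show "continuous_on UNIV H"
      unfolding H_def by (intro continuous_intros)
  qed
  then show ?thesis
    by (simp add: n_def)
qed

text \<open>The second derivative is the defect in the Cauchy-Schwarz inequality for \<open>v\<close> and \<open>w\<close>, which is why it
  vanishes only for collinear vectors.\<close>

lemma norm_along_line:
  fixes v w :: "'a::real_inner"
  assumes v: "v \<noteq> 0"
  shows "\<forall>\<^sub>F t in nhds 0. ((\<lambda>t. norm (v + t *\<^sub>R w)) has_real_derivative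
           ((v + t *\<^sub>R w) \<bullet> w) / norm (v + t *\<^sub>R w)) (at t)"
    and "((\<lambda>t. ((v + t *\<^sub>R w) \<bullet> w) / norm (v + t *\<^sub>R w)) has_real_derivative
           ((norm v * norm w)\<^sup>2 - (v \<bullet> w)\<^sup>2) / norm v ^ 3) (at 0)"
proof -
  have d: "((\<lambda>t. norm (v + t *\<^sub>R w)) has_real_derivative
           ((v + t *\<^sub>R w) \<bullet> w) / norm (v + t *\<^sub>R w)) (at t)" if "v + t *\<^sub>R w \<noteq> 0" for t
  proof -
    have "((\<lambda>t. v + t *\<^sub>R w) has_derivative (\<lambda>s. s *\<^sub>R w)) (at t)"
      by (auto intro!: derivative_eq_intros)
    from has_derivative_compose[OF this has_derivative_norm[OF that]]
    have "((\<lambda>t. norm (v + t *\<^sub>R w)) has_derivative (\<lambda>s. (s *\<^sub>R w) \<bullet> sgn (v + t *\<^sub>R w))) (at t)" .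
    moreover have "(\<lambda>s. (s *\<^sub>R w) \<bullet> sgn (v + t *\<^sub>R w)) = (*) (((v + t *\<^sub>R w) \<bullet> w) / norm (v + t *\<^sub>R w))"
      by (auto simp: sgn_div_norm inner_commute divide_inverse)
    ultimately show ?thesis
      by (simp add: has_field_derivative_def)
  qed
  have "\<forall>\<^sub>F t in nhds 0. v + t *\<^sub>R w \<noteq> 0"
    using v by (intro eventually_along_line t1_space_nhds)
  then show "\<forall>\<^sub>F t in nhds 0. ((\<lambda>t. norm (v + t *\<^sub>R w)) has_real_derivative
           ((v + t *\<^sub>R w) \<bullet> w) / norm (v + t *\<^sub>R w)) (at t)"
    by eventually_elim (rule d)
  have n: "((\<lambda>t. (v + t *\<^sub>R w) \<bullet> w) has_real_derivative w \<bullet> w) (at 0)"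
  proof -
    have "((\<lambda>t. v \<bullet> w + t * (w \<bullet> w)) has_real_derivative w \<bullet> w) (at 0)"
      by (auto intro!: derivative_eq_intros)
    then show ?thesis
      by (simp add: inner_add_left)
  qed
  have "((\<lambda>t. ((v + t *\<^sub>R w) \<bullet> w) / norm (v + t *\<^sub>R w)) has_real_derivative
       ((w \<bullet> w) * norm v - (v \<bullet> w) * ((v \<bullet> w) / norm v)) / (norm v * norm v)) (at 0)"
    using DERIV_divide[OF n d] v by simp
  moreover have "((w \<bullet> w) * norm v - (v \<bullet> w) * ((v \<bullet> w) / norm v)) / (norm v * norm v)
       = ((norm v * norm w)\<^sup>2 - (v \<bullet> w)\<^sup>2) / norm v ^ 3"
    using v by (simp add: field_simps power2_eq_square power3_eq_cube flip: power2_norm_eq_inner)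
  ultimately show "((\<lambda>t. ((v + t *\<^sub>R w) \<bullet> w) / norm (v + t *\<^sub>R w)) has_real_derivative
           ((norm v * norm w)\<^sup>2 - (v \<bullet> w)\<^sup>2) / norm v ^ 3) (at 0)"
    by simp
qed

lemma Cauchy_Schwarz_equality_collinear:
  fixes v w :: "'a::real_inner"
  assumes "v \<noteq> 0" "(v \<bullet> w)\<^sup>2 = (norm v * norm w)\<^sup>2"
  shows "w = ((v \<bullet> w) / (norm v)\<^sup>2) *\<^sub>R v"
proof -
  let ?k = "(v \<bullet> w) / (norm v)\<^sup>2"
  have "(norm (w - ?k *\<^sub>R v))\<^sup>2 = (norm w)\<^sup>2 - 2 * ?k * (v \<bullet> w) + ?k\<^sup>2 * (norm v)\<^sup>2"
    unfolding power2_norm_eq_inner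
    by (simp add: inner_diff_left inner_diff_right inner_commute power2_eq_square algebra_simps)
  also have "\<dots> = (norm w)\<^sup>2 - (v \<bullet> w)\<^sup>2 / (norm v)\<^sup>2"
    using assms(1) by (simp add: field_simps power2_eq_square)
  also have "\<dots> = 0"
    using assms by (simp add: power_mult_distrib)
  finally show ?thesis
    by simp
qed

text \<open>A smooth representative must be \<open>C\<^sup>2\<close> on the whole space, while the norm is not differentiable at the origin;
  hence the modified square root of \<open>norm (A x)\<^sup>2\<close>.\<close>

lemma C2_local_norm:
  fixes A :: "real^'p^'m"
  assumes "A *v \<beta> \<noteq> 0"
  shows "\<exists>f. C2 f \<and> (\<forall>\<^sub>F x in nhds \<beta>. norm (A *v x) = f x)"
proof -
  \<comment> \<open>Any positive number below \<open>norm (A \<beta>)\<^sup>2\<close> would do: nothing changes where \<open>norm (A x)\<^sup>2 \<ge> a\<close>.\<close>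
  define a where "a = (norm (A *v \<beta>))\<^sup>2 / 2"
  have a: "0 < a" "a < (norm (A *v \<beta>))\<^sup>2"
    using assms by (auto simp: a_def)
  obtain s s' s'' where s: "\<forall>r. (s has_real_derivative s' r) (at r)"
    "\<forall>r. (s' has_real_derivative s'' r) (at r)" "continuous_on UNIV s''"
    and sqrt: "\<forall>r\<ge>a. s r = sqrt r"
    using smooth_extension_of_sqrt[OF a(1)] .
  have "open {x. a < (norm (A *v x))\<^sup>2}"
    by (intro open_Collect_less continuous_intros)
  then have "\<forall>\<^sub>F x in nhds \<beta>. x \<in> {x. a < (norm (A *v x))\<^sup>2}"
    using a(2) by (intro eventually_nhds_in_open) auto
  then have "\<forall>\<^sub>F x in nhds \<beta>. norm (A *v x) = s ((A *v x) \<bullet> (A *v x))"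
    by eventually_elim (simp add: sqrt flip: power2_norm_eq_inner)
  then show ?thesis
    using C2_compose_square_norm[OF spec[OF s(1)] spec[OF s(2)] s(3)] by blast
qed

section \<open>Group penalties\<close>

lemma matrix_vector_inner_transpose:
  fixes D :: "real^'r^'p"
  shows "(D *v z) \<bullet> x = z \<bullet> (transpose D *v x)"
  by (metis dot_lmul_matrix inner_commute transpose_matrix_vector)

text \<open>Each \<open>p b\<close> is a subgradient of the norm at \<open>D b\<^sup>T \<beta>\<close>, by Cauchy-Schwarz;
  the inequalities are added up.\<close>

lemma group_subgradientI:
  fixes D :: "'b \<Rightarrow> real^'r^'p"
  assumes "finite B"
    and p: "\<And>b. b \<in> B \<Longrightarrow> norm (p b) \<le> 1"
    and tight: "\<And>b. b \<in> B \<Longrightarrow> p b \<bullet> (transpose (D b) *v \<beta>) = norm (transpose (D b) *v \<beta>)"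
  shows "(\<Sum>b\<in>B. D b *v p b) \<in> subdiff (general_group_lasso B D) \<beta>"
proof -
  have eq: "(\<Sum>b\<in>B. D b *v p b) \<bullet> x = (\<Sum>b\<in>B. p b \<bullet> (transpose (D b) *v x))" for x
    by (simp only: inner_sum_left matrix_vector_inner_transpose)
  have "p b \<bullet> w \<le> norm w" if "b \<in> B" for b w
    using norm_cauchy_schwarz[of "p b" w] mult_right_mono[OF p[OF that], of "norm w"] by simp
  then have "(\<Sum>b\<in>B. p b \<bullet> (transpose (D b) *v x)) \<le> (\<Sum>b\<in>B. norm (transpose (D b) *v x))" for x
    by (intro sum_mono)
  moreover have "(\<Sum>b\<in>B. p b \<bullet> (transpose (D b) *v \<beta>)) = (\<Sum>b\<in>B. norm (transpose (D b) *v \<beta>))"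
    using tight by (intro sum.cong) auto
  ultimately have "(\<Sum>b\<in>B. norm (transpose (D b) *v \<beta>)) + (\<Sum>b\<in>B. D b *v p b) \<bullet> (x - \<beta>)
      \<le> (\<Sum>b\<in>B. norm (transpose (D b) *v x))" for x
    unfolding inner_diff_right eq by simp
  then show ?thesis
    unfolding subdiff_def general_group_lasso_def by (simp del: transpose_matrix_vector)
qed

text \<open>In a block with \<open>D b\<^sup>T \<beta> = 0\<close>, the vector \<open>p b\<close> of a subgradient may be any \<open>z\<close> in the unit ball, so
  \<open>h\<close> is orthogonal to \<open>D b z\<close>. Choosing \<open>z\<close> as the direction of \<open>D b\<^sup>T h\<close> shows that the latter
  is zero.\<close>

lemma group_model_space_vanishes:
  fixes D :: "'b \<Rightarrow> real^'r^'p"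
  assumes B: "finite B" and b: "b \<in> B" and zero: "transpose (D b) *v \<beta> = 0"
    and h: "h \<in> model_space (general_group_lasso B D) \<beta>"
  shows "transpose (D b) *v h = 0"
proof -
  define p where "p z b' = (if b' = b then z else sgn (transpose (D b') *v \<beta>))" for z b'
  have sgn_inner: "sgn v \<bullet> v = norm v" for v :: "real^'r"
    by (cases "v = 0") (simp_all add: sgn_div_norm dot_square_norm power2_eq_square)
  have sub: "(\<Sum>b'\<in>B. D b' *v p z b') \<in> subdiff (general_group_lasso B D) \<beta>" if "norm z \<le> 1" for z
  proof (rule group_subgradientI[OF B])
    show "norm (p z b') \<le> 1" for b'
      using that by (simp add: p_def norm_sgn)
    show "p z b' \<bullet> (transpose (D b') *v \<beta>) = norm (transpose (D b') *v \<beta>)" for b'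
      using zero sgn_inner by (simp add: p_def del: transpose_matrix_vector)
  qed
  have split: "(\<Sum>b'\<in>B. D b' *v p z b') = D b *v z + (\<Sum>b'\<in>B - {b}. D b' *v sgn (transpose (D b') *v \<beta>))" for z
    using B b by (subst sum.remove[of _ b]) (auto simp: p_def intro!: sum.cong)
  define z where "z = sgn (transpose (D b) *v h)"
  have "norm z \<le> 1" "norm (0 :: real^'r) \<le> 1"
    by (simp_all add: z_def norm_sgn)
  then have "(\<Sum>b'\<in>B. D b' *v p z b') \<bullet> h = (\<Sum>b'\<in>B. D b' *v p 0 b') \<bullet> h"
    using h[unfolded model_space_iff] sub by blast
  then have "z \<bullet> (transpose (D b) *v h) = 0"
    unfolding split by (simp add: inner_add_left matrix_vector_inner_transpose)
  then show ?thesis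
    by (simp add: z_def sgn_div_norm)
qed

text \<open>The penalty is positively homogeneous, so every subgradient \<open>u\<close> satisfies \<open>u \<bullet> \<beta> = J \<beta>\<close> (compare with
  \<open>0\<close> and \<open>2 \<beta>\<close>). This is why \<open>T\<^sub>\<beta>\<close> itself can serve as a manifold through \<open>\<beta>\<close>.\<close>

lemma group_base_point_in_model_space:
  "\<beta> \<in> model_space (general_group_lasso B D) \<beta>"
proof -
  have "u \<bullet> \<beta> = (\<Sum>b\<in>B. norm (transpose (D b) *v \<beta>))"
    if u: "u \<in> subdiff (general_group_lasso B D) \<beta>" for u
  proof -
    have sub: "(\<Sum>b\<in>B. norm (transpose (D b) *v \<beta>)) + u \<bullet> (z - \<beta>) \<le> (\<Sum>b\<in>B. norm (transpose (D b) *v z))" for z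
      using u by (simp add: subdiff_def general_group_lasso_def)
    have "(\<Sum>b\<in>B. norm (transpose (D b) *v (2 *\<^sub>R \<beta>))) = 2 * (\<Sum>b\<in>B. norm (transpose (D b) *v \<beta>))"
      by (simp add: matrix_vector_mult_scaleR sum_distrib_left del: transpose_matrix_vector)
    then show ?thesis
      using sub[of 0] sub[of "2 *\<^sub>R \<beta>"]
      by (simp add: inner_diff_right del: transpose_matrix_vector)
  qed
  then show ?thesis
    unfolding model_space_iff by simp
qed

lemma convex_closed_general_group_lasso:
  fixes D :: "'b \<Rightarrow> real^'r^'p"
  shows "convex_fun (general_group_lasso B D)" "closed (epi (general_group_lasso B D))"
proof -
  let ?j = "\<lambda>x. \<Sum>b\<in>B. norm (transpose (D b) *v x)"
  have epi: "epi (general_group_lasso B D) = {p. ?j (fst p) \<le> snd p}"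
    by (auto simp: epi_def general_group_lasso_def)
  show "closed (epi (general_group_lasso B D))"
    unfolding epi
    by (intro closed_Collect_le continuous_intros
        continuous_on_compose2[OF matrix_vector_mult_linear_continuous_on[of UNIV]]) auto
  have j: "?j (u *\<^sub>R x + v *\<^sub>R z) \<le> u * ?j x + v * ?j z" if "0 \<le> u" "0 \<le> v" for u v x z
  proof -
    have "?j (u *\<^sub>R x + v *\<^sub>R z)
        \<le> (\<Sum>b\<in>B. u * norm (transpose (D b) *v x) + v * norm (transpose (D b) *v z))"
    proof (rule sum_mono)
      fix b
      show "norm (transpose (D b) *v (u *\<^sub>R x + v *\<^sub>R z))
          \<le> u * norm (transpose (D b) *v x) + v * norm (transpose (D b) *v z)"
        using norm_triangle_ineq[of "u *\<^sub>R (transpose (D b) *v x)" "v *\<^sub>R (transpose (D b) *v z)"] that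
        by (simp add: matrix_vector_right_distrib matrix_vector_mult_scaleR del: transpose_matrix_vector)
    qed
    then show ?thesis
      by (simp add: sum.distrib sum_distrib_left)
  qed
  show "convex_fun (general_group_lasso B D)"
    unfolding convex_fun_def epi
  proof (rule convexI)
    fix p q and u v :: real
    assume pq: "p \<in> {p. ?j (fst p) \<le> snd p}" "q \<in> {p. ?j (fst p) \<le> snd p}" and uv: "0 \<le> u" "0 \<le> v"
    have "u * ?j (fst p) + v * ?j (fst q) \<le> u * snd p + v * snd q"
      using pq uv by (intro add_mono mult_left_mono) auto
    with j[OF uv, of "fst p" "fst q"] show "u *\<^sub>R p + v *\<^sub>R q \<in> {p. ?j (fst p) \<le> snd p}"
      by simp
  qed
qed

text \<open>On \<open>T\<^sub>\<beta>\<close> the blocks that vanish at \<open>\<beta>\<close> contribute nothing, and near \<open>\<beta>\<close> the other ones stay away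
  from the origin.\<close>

lemma group_smooth_representative:
  fixes D :: "'b \<Rightarrow> real^'r^'p"
  assumes B: "finite B"
  shows "\<exists>Jt. smooth_representative (general_group_lasso B D)
    (linear_manifold (general_group_lasso B D) \<beta>) \<beta> Jt"
proof -
  define act where "act = {b \<in> B. transpose (D b) *v \<beta> \<noteq> 0}"
  have ex: "\<forall>b\<in>act. \<exists>f. C2 f \<and> (\<forall>\<^sub>F x in nhds \<beta>. norm (transpose (D b) *v x) = f x)"
    using C2_local_norm unfolding act_def by blast
  obtain f where f: "\<forall>b\<in>act. C2 (f b) \<and> (\<forall>\<^sub>F x in nhds \<beta>. norm (transpose (D b) *v x) = f b x)"
    using bchoice[OF ex] by (elim exE)
  have "\<forall>\<^sub>F x in nhds \<beta>. \<forall>b\<in>act. norm (transpose (D b) *v x) = f b x"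
    using f B by (intro eventually_ball_finite) (auto simp: act_def)
  then have "\<forall>\<^sub>F x in nhds \<beta>. x \<in> linear_manifold (general_group_lasso B D) \<beta> \<longrightarrow>
      general_group_lasso B D x = ereal (\<Sum>b\<in>act. f b x)"
  proof eventually_elim
    case (elim x)
    show ?case
    proof
      assume x: "x \<in> linear_manifold (general_group_lasso B D) \<beta>"
      have "(\<Sum>b\<in>B. norm (transpose (D b) *v x)) = (\<Sum>b\<in>act. norm (transpose (D b) *v x))"
        using group_model_space_vanishes[OF B] x B
        by (intro sum.mono_neutral_right) (auto simp: act_def linear_manifold_def simp del: transpose_matrix_vector)
      then show "general_group_lasso B D x = ereal (\<Sum>b\<in>act. f b x)"
        using elim by (simp add: general_group_lasso_def del: transpose_matrix_vector)
    qed
  qed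
  moreover have "C2 (\<lambda>x. \<Sum>b\<in>act. f b x)"
    using f by (intro C2_sum) blast
  ultimately show ?thesis
    unfolding smooth_representative_def by (intro exI conjI)
qed

text \<open>The second derivative is a sum of nonnegative Cauchy-Schwarz defects. If it vanishes, every
  \<open>D b\<^sup>T \<xi>\<close> is a multiple \<open>k b\<close> of \<open>D b\<^sup>T \<beta>\<close>, and near \<open>t = 0\<close> each norm equals
  \<open>(1 + t k b)\<close> times its value at \<open>0\<close>, which is affine in \<open>t\<close>.\<close>

lemma group_lasso_along_line:
  fixes D :: "'b \<Rightarrow> real^'r^'p"
  assumes B: "finite B" and \<xi>: "\<xi> \<in> model_space (general_group_lasso B D) \<beta>"
  shows "\<exists>\<phi> \<phi>' q c k.
        (\<forall>\<^sub>F t in nhds 0. general_group_lasso B D (\<beta> + t *\<^sub>R \<xi>) = ereal (\<phi> t)) \<and>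
        (\<forall>\<^sub>F t in nhds 0. (\<phi> has_real_derivative \<phi>' t) (at t)) \<and>
        (\<phi>' has_real_derivative q) (at 0) \<and> q \<ge> 0 \<and>
        (q = 0 \<longrightarrow> (\<forall>\<^sub>F t in nhds 0. \<phi> t = c + t * k))"
proof -
  define v w where "v b = transpose (D b) *v \<beta>" and "w b = transpose (D b) *v \<xi>" for b
  define act where "act = {b \<in> B. v b \<noteq> 0}"
  have act: "finite act" "act \<subseteq> B"
    using B by (auto simp: act_def)
  let ?n = "\<lambda>b t. norm (v b + t *\<^sub>R w b)"
  let ?q = "\<lambda>b. ((norm (v b) * norm (w b))\<^sup>2 - (v b \<bullet> w b)\<^sup>2) / norm (v b) ^ 3"
  \<comment> \<open>The candidate for the ratio of \<open>w b\<close> to \<open>v b\<close>.\<close>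
  define k where "k b = (v b \<bullet> w b) / (norm (v b))\<^sup>2" for b
  have v: "v b \<noteq> 0" if "b \<in> act" for b
    using that by (simp add: act_def)
  have "general_group_lasso B D (\<beta> + t *\<^sub>R \<xi>) = ereal (\<Sum>b\<in>act. ?n b t)" for t
  proof -
    have "transpose (D b) *v (\<beta> + t *\<^sub>R \<xi>) = v b + t *\<^sub>R w b" for b
      by (simp add: v_def w_def matrix_vector_right_distrib matrix_vector_mult_scaleR
          del: transpose_matrix_vector)
    moreover have "(\<Sum>b\<in>B. ?n b t) = (\<Sum>b\<in>act. ?n b t)"
      using group_model_space_vanishes[OF B _ _ \<xi>] act B
      by (intro sum.mono_neutral_right) (auto simp: act_def v_def w_def simp del: transpose_matrix_vector)
    ultimately show ?thesis
      by (simp add: general_group_lasso_def del: transpose_matrix_vector)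
  qed
  then have line: "\<forall>\<^sub>F t in nhds 0. general_group_lasso B D (\<beta> + t *\<^sub>R \<xi>) = ereal (\<Sum>b\<in>act. ?n b t)"
    by simp
  have "\<forall>\<^sub>F t in nhds 0. \<forall>b\<in>act. (?n b has_real_derivative ((v b + t *\<^sub>R w b) \<bullet> w b) / ?n b t) (at t)"
    using norm_along_line(1) v act(1) by (intro eventually_ball_finite ballI) blast+
  then have first: "\<forall>\<^sub>F t in nhds 0. ((\<lambda>t. \<Sum>b\<in>act. ?n b t) has_real_derivative
      (\<Sum>b\<in>act. ((v b + t *\<^sub>R w b) \<bullet> w b) / ?n b t)) (at t)"
    by eventually_elim (intro DERIV_sum, blast)
  have second: "((\<lambda>t. \<Sum>b\<in>act. ((v b + t *\<^sub>R w b) \<bullet> w b) / ?n b t) has_real_derivative (\<Sum>b\<in>act. ?q b)) (at 0)"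
    by (intro DERIV_sum norm_along_line(2) v)
  have q: "?q b \<ge> 0" for b
  proof -
    have "\<bar>v b \<bullet> w b\<bar> \<le> norm (v b) * norm (w b)"
      by (rule Cauchy_Schwarz_ineq2)
    then have "(v b \<bullet> w b)\<^sup>2 \<le> (norm (v b) * norm (w b))\<^sup>2"
      by (intro abs_le_square_iff[THEN iffD1]) simp
    then show ?thesis
      by simp
  qed
  have "\<forall>\<^sub>F t in nhds 0. (\<Sum>b\<in>act. ?n b t) = (\<Sum>b\<in>act. norm (v b)) + t * (\<Sum>b\<in>act. k b * norm (v b))"
    if "(\<Sum>b\<in>act. ?q b) = 0"
  proof -
    have "\<forall>b\<in>act. ?q b = 0"
      using that q act(1) by (subst (asm) sum_nonneg_eq_0_iff) auto
    then have collinear: "w b = k b *\<^sub>R v b" if "b \<in> act" for b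
      using Cauchy_Schwarz_equality_collinear[of "v b" "w b"] v[OF that] that unfolding k_def by force
    have "\<forall>\<^sub>F t in nhds 0. 1 + t * k b > 0" for b
    proof -
      have "((\<lambda>t. 1 + t * k b) \<longlongrightarrow> 1 + 0 * k b) (nhds 0)"
        by (intro tendsto_intros filterlim_ident)
      then show ?thesis
        by (rule order_tendstoD) simp
    qed
    then have "\<forall>\<^sub>F t in nhds 0. \<forall>b\<in>act. 1 + t * k b > 0"
      using act(1) by (intro eventually_ball_finite) auto
    then show ?thesis
    proof eventually_elim
      case (elim t)
      have "?n b t = norm (v b) + t * (k b * norm (v b))" if b: "b \<in> act" for b
      proof -
        have "v b + t *\<^sub>R w b = (1 + t * k b) *\<^sub>R v b"
          by (simp add: collinear[OF b] scaleR_add_left)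
        then have "?n b t = \<bar>1 + t * k b\<bar> * norm (v b)"
          by simp
        then show ?thesis
          using elim b by (simp add: abs_of_pos distrib_right)
      qed
      then show ?case
        by (simp add: sum.distrib sum_distrib_left)
    qed
  qed
  then show ?thesis
    using line first second sum_nonneg[of act ?q, OF q]
    by (intro exI[of _ "\<lambda>t. \<Sum>b\<in>act. ?n b t"]
        exI[of _ "\<lambda>t. \<Sum>b\<in>act. ((v b + t *\<^sub>R w b) \<bullet> w b) / ?n b t"] exI[of _ "\<Sum>b\<in>act. ?q b"]
        exI[of _ "\<Sum>b\<in>act. norm (v b)"] exI[of _ "\<Sum>b\<in>act. k b * norm (v b)"] conjI impI)
qed

lemma non_injectivity_set_group:
  fixes X :: "real^'p^'n" and D :: "'b \<Rightarrow> real^'r^'p"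
  assumes B: "finite B"
    and F: "\<And>y. twice_differentiable (\<lambda>\<beta>. fidelity X F0 \<beta> y)"
    and F0: "\<And>y. twice_differentiable (\<lambda>\<mu>. F0 \<mu> y)"
    and pd: "\<And>\<mu> y. positive_definite (hess (\<lambda>m. F0 m y) \<mu>)"
    and ker: "{h. X *v h = 0} \<inter> constancy_space (general_group_lasso B D) = {0}"
  shows "non_injectivity_set (fidelity X F0) (general_group_lasso B D)
    (linear_manifold (general_group_lasso B D)) = {}"
proof (rule non_injectivity_set_emptyI[OF _ convex_closed_general_group_lasso F0 pd ker])
  let ?J = "general_group_lasso B D"
  show "proper_fun ?J"
    by (simp add: proper_fun_def general_group_lasso_def)
  fix y \<beta>
  assume \<beta>: "\<beta> extreme_point_of minimizers (fidelity X F0) ?J y"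
  obtain Jt where Jt: "smooth_representative ?J (linear_manifold ?J \<beta>) \<beta> Jt"
    using group_smooth_representative[OF B] by blast
  show "injectivity_condition (fidelity X F0) ?J (linear_manifold ?J) \<beta> y"
  proof (rule injectivity_condition_at_extreme_minimizer[of X F0 y \<beta> ?J "linear_manifold ?J" Jt, OF F F0 pd \<beta> Jt])
    fix \<xi> and t :: real assume \<xi>: "\<xi> \<in> model_space ?J \<beta>"
    then show "\<beta> + t *\<^sub>R \<xi> \<in> linear_manifold ?J \<beta>"
      unfolding linear_manifold_def
      by (intro subspace_add[OF subspace_model_space] subspace_scale[OF subspace_model_space]
          group_base_point_in_model_space)
  qed (rule group_lasso_along_line[OF B])
qed

text \<open>The coordinate projection onto a block plays the role of \<open>D b\<close>.\<close>

lemma group_lasso_eq_general_group_lasso: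
  fixes B :: "'p::finite set set"
  shows "group_lasso B = general_group_lasso B (\<lambda>b. \<chi> i j. if i = j \<and> i \<in> b then 1 else 0)"
proof -
  have "L2_set (\<lambda>i. x $ i) b = norm (transpose (\<chi> i j. if i = j \<and> i \<in> b then 1 else 0) *v x)"
    for x :: "real^'p" and b :: "'p set"
  proof -
    have "transpose (\<chi> i j. if i = j \<and> i \<in> b then 1 else 0) *v x = (\<chi> i. if i \<in> b then x $ i else 0)"
    proof -
      have "(if j = i \<and> j \<in> b then 1 else 0) * x $ j = (if j = i then (if i \<in> b then x $ i else 0) else 0)"
        for i j
        by auto
      then show ?thesis
        by (simp add: vec_eq_iff matrix_vector_mult_def transpose_def)
    qed
    then show ?thesis
      by (simp add: norm_vec_def L2_set_def if_distrib[of norm] if_distrib[of "\<lambda>c. c\<^sup>2"] sum.If_cases cong: if_cong)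
  qed
  then have "(\<Sum>b\<in>B. L2_set (\<lambda>i. x $ i) b)
      = (\<Sum>b\<in>B. norm (transpose (\<chi> i j. if i = j \<and> i \<in> b then 1 else 0) *v x))" for x :: "real^'p"
    by (intro sum.cong) auto
  then show ?thesis
    unfolding fun_eq_iff group_lasso_def general_group_lasso_def by metis
qed

section \<open>The non-injectivity set is empty\<close>

theorem proposition1:
  fixes X :: "real^'p^'n"
    and F0 :: "real^'n \<Rightarrow> real^'n \<Rightarrow> real"
  assumes F_C2_fst: "\<And>y. C2 (\<lambda>\<beta>. fidelity X F0 \<beta> y)"
    and F_C2_snd: "\<And>\<beta>. C2 (\<lambda>y. fidelity X F0 \<beta> y)"
    and F0_twice: "\<And>y. twice_differentiable (\<lambda>\<mu>. F0 \<mu> y)"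
    and F0_posdef: "\<And>\<mu> y. positive_definite (hess (\<lambda>m. F0 m y) \<mu>)"
  shows
    "(\<forall>J :: real^'p \<Rightarrow> ereal.
        proper_fun J \<and> lsc_fun J \<and> convex_fun J \<and> polyhedral_fun J \<and>
        {h. X *v h = 0} \<inter> constancy_space J = {0} \<longrightarrow>
        non_injectivity_set (fidelity X F0) J
          (affine_manifold J) = {}) \<and>
     non_injectivity_set (fidelity X F0) lasso
          (affine_manifold lasso) = {} \<and>
     (\<forall>D :: real^'q^'p.
        {h. X *v h = 0} \<inter> constancy_space (general_lasso D) = {0} \<longrightarrow>
        non_injectivity_set (fidelity X F0) (general_lasso D)
          (affine_manifold (general_lasso D)) = {}) \<and>
     non_injectivity_set (fidelity X F0) linf_penalty
          (affine_manifold linf_penalty) = {} \<and>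
     (\<forall>(B :: 'b set) (D :: 'b \<Rightarrow> real^'r^'p).
        finite B \<and> {h. X *v h = 0} \<inter> constancy_space (general_group_lasso B D) = {0} \<longrightarrow>
        non_injectivity_set (fidelity X F0) (general_group_lasso B D)
          (linear_manifold (general_group_lasso B D)) = {}) \<and>
     (\<forall>B :: 'p set set. partition_on UNIV B \<longrightarrow>
        non_injectivity_set (fidelity X F0) (group_lasso B)
          (linear_manifold (group_lasso B)) = {})"
proof -
  have F: "twice_differentiable (\<lambda>\<beta>. fidelity X F0 \<beta> y)" for y
    using F_C2_fst by (simp add: C2_def)
  note polyhedral = non_injectivity_set_polyhedral[OF _ _ F F0_twice F0_posdef]
  note group = non_injectivity_set_group[OF _ F F0_twice F0_posdef]
  have gl: "non_injectivity_set (fidelity X F0) (general_lasso D) (affine_manifold (general_lasso D)) = {}"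
    if "{h. X *v h = 0} \<inter> constancy_space (general_lasso D) = {0}" for D :: "real^'s^'p"
    using polyhedral_general_lasso that
    by (intro polyhedral) (auto simp: proper_fun_def general_lasso_def lasso_def)
  have "constancy_space (lasso :: real^'p \<Rightarrow> ereal) = {0}"
    by (rule constancy_space_trivial) (simp add: lasso_def sum_nonneg_eq_0_iff vec_eq_iff)
  then have lasso: "non_injectivity_set (fidelity X F0) lasso (affine_manifold lasso) = {}"
    using gl[of "mat 1"] unfolding lasso_eq_general_lasso[symmetric] by force
  have "constancy_space (linf_penalty :: real^'p \<Rightarrow> ereal) = {0}"
    by (rule constancy_space_trivial) (simp add: linf_penalty_def infnorm_eq_0 infnorm_0)
  then have linf: "non_injectivity_set (fidelity X F0) linf_penalty (affine_manifold linf_penalty) = {}"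
    using polyhedral_linf by (intro polyhedral) (auto simp: proper_fun_def linf_penalty_def)
  have grp: "non_injectivity_set (fidelity X F0) (group_lasso B) (linear_manifold (group_lasso B)) = {}"
    if B: "partition_on UNIV B" for B :: "'p set set"
  proof -
    have fin: "finite B"
      by simp
    have "constancy_space (group_lasso B) = {0}"
    proof (rule constancy_space_trivial)
      fix h :: "real^'p" assume "group_lasso B h = group_lasso B 0"
      then have "(\<Sum>b\<in>B. L2_set (\<lambda>i. h $ i) b) = 0"
        by (simp add: group_lasso_def L2_set_def)
      then have "L2_set (\<lambda>i. h $ i) b = 0" if "b \<in> B" for b
        using that by (simp add: sum_nonneg_eq_0_iff L2_set_nonneg)
      then have zero: "h $ i = 0" if "b \<in> B" "i \<in> b" for b i
        using that by (simp add: L2_set_eq_0_iff)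
      have "h $ i = 0" for i
        using partition_onD1[OF B] zero by blast
      then show "h = 0"
        by (simp add: vec_eq_iff)
    qed
    then have "{h. X *v h = 0} \<inter> constancy_space (group_lasso B) = {0}"
      by auto
    then show ?thesis
      unfolding group_lasso_eq_general_group_lasso by (rule group[OF fin])
  qed
  show ?thesis
    by (intro conjI allI impI; (elim conjE)?; rule polyhedral gl lasso linf group grp; assumption)
qed

end
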